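(* Let $K\ge1$. Let $\Sigma_0^{(K)}$ be the graph with jump matrices depending on $(y_1,\dots,y_{2K})\in(\mathbb C^\times)^{2K}$ described in the context, and let $\Omega(\Sigma_0^{(K)})$ be its associated standard two-form. Then $$\Omega\big(\Sigma_0^{(K)}\big)=8\sum_{j=1}^{K}\sum_{l=j}^{K}d\log y_{2j-1}\wedge d\log y_{2l}.$$ In particular, it is symplectic.
   Context: **Standard two-form.** Let $\Sigma$ be an oriented graph with a jump matrix $J(e)\in SL_2$ on each oriented edge, such that $J(-e)=J(e)^{-1}$ ($-e$ is the reversed edge) and, at each vertex $v$, the product $J_1\cdots J_{n_v}$ of the matrices on the incident edges, oriented away from $v$ and listed counterclockwise, is the identity. Then $$\Omega(\Sigma)=\sum_{v}\sum_{k=1}^{n_v-1}\mathrm{Tr}\Big((J_1\cdots J_k)^{-1}d(J_1\cdots J_k)\wedge J_k^{-1}dJ_k\Big),\qquad \mathrm{Tr}(M\wedge N)=\sum_{i,j}M_{ij}\wedge N_{ji},$$ which is independent of the choice of first edge at each vertex. **The graph $\Sigma_0^{(K)}$.** It is obtained from a regular $(2K+2)$-gon with vertices $v_1,\dots,v_{2K+2}$ (numbered counterclockwise) by adding one infinite ray at each $v_j$, the diagonals joining $v_{2K+2}$ to $v_2,\dots,v_{2K}$, and, inside each of the $2K$ resulting triangles, a vertex $z_j$ joined to the three vertices of the triangle. Put $$D(x)=\begin{pmatrix}x^{-1}&0\\ 0&x\end{pmatrix},\quad V(x)=\begin{pmatrix}0&-x\\ x^{-1}&0\end{pmatrix},\quad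 A=\begin{pmatrix}0&1\\ -1&-1\end{pmatrix}\ (A^3=\mathbf 1),$$ $x_1=y_1$, $x_l=\prod_{j=1}^ly_j^{(-1)^{j+1}}$ for $2\le l\le2K$, and $x_{2K+1}=x_{2K}$. The counterclockwise lists of outgoing jump matrices at the vertices are: - at $v_1$: $V(y_1^{-1}),\,A,\,D(y_1)^{-1},\,S_1$; - at $v_{2k}$, $1\le k\le K$: $D(x_{2k}),\,A,\,V(y_{2k})^{-1},\,A,\,V(x_{2k-1}^{-1})^{-1},\,S_{2k}$; - at $v_{2k+1}$, $1\le k\le K-1$: $V(x_{2k+1}^{-1}),\,A,\,V(y_{2k+1}),\,A,\,D(x_{2k})^{-1},\,S_{2k+1}$; - at $v_{2K+1}$: $V(x_{2K+1}^{-1}),\,A,\,D(x_{2K})^{-1},\,S_{2K+1}$; - at $v_{2K+2}$: $D(y_1),\,A,\,V(y_2),\,A,\,V(y_3)^{-1},\,A,\dots,A,\,V(y_{2K}),\,A,\,V(x_{2K+1}^{-1})^{-1},\,S_{2K+2}\Lambda$ (the diagonal to $v_j$ carries $V(y_j)^{(-1)^j}$, $2\le j\le2K$); - at each $z_j$: $A^{-1},A^{-1},A^{-1}$. The last matrix in the list at each $v_j$ (on the infinite ray) is determined by requiring that the product of the list be $\mathbf 1$. *)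

theory Defs
  imports "HOL-Analysis.Analysis"
begin

section \<open>Holomorphic differential forms on open subsets of \<open>\<complex>\<^sup>n\<close>\<close>

text \<open>
  A one-form takes a point and a tangent vector; a two-form takes a point and two tangent
  vectors. The wedge product of one-forms is
  \<open>(\<alpha> \<and> \<beta>)(u, w) = \<alpha>(u) \<beta>(w) - \<alpha>(w) \<beta>(u)\<close>.
\<close>

type_synonym 'n one_form = "complex^'n \<Rightarrow> complex^'n \<Rightarrow> complex"
type_synonym 'n two_form = "complex^'n \<Rightarrow> complex^'n \<Rightarrow> complex^'n \<Rightarrow> complex"

definition wedge :: "'n::finite one_form \<Rightarrow> 'n one_form \<Rightarrow> 'n two_form" where
  "wedge \<alpha> \<beta> p u w = \<alpha> p u * \<beta> p w - \<alpha> p w * \<beta> p u"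

definition dlog :: "(complex^'n::finite \<Rightarrow> complex) \<Rightarrow> 'n one_form" where
  "dlog f p u = frechet_derivative f (at p) u / f p"

definition holomorphic_map_on :: "(complex^'n::finite \<Rightarrow> complex) \<Rightarrow> (complex^'n) set \<Rightarrow> bool" where
  "holomorphic_map_on f U \<longleftrightarrow>
     (\<forall>p\<in>U. \<exists>f'. (f has_derivative f') (at p) \<and> Vector_Spaces.linear (*s) (*) f')"

definition holomorphic_two_form_on :: "(complex^'n::finite) set \<Rightarrow> 'n two_form \<Rightarrow> bool" where
  "holomorphic_two_form_on U \<omega> \<longleftrightarrow>
     (\<forall>p\<in>U. (\<forall>w. Vector_Spaces.linear (*s) (*) (\<lambda>u. \<omega> p u w)) \<and>
             (\<forall>u. Vector_Spaces.linear (*s) (*) (\<lambda>w. \<omega> p u w)) \<and>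
             (\<forall>u. \<omega> p u u = 0)) \<and>
     (\<forall>u w. holomorphic_map_on (\<lambda>p. \<omega> p u w) U)"

text \<open>
  The exterior derivative, evaluated on constant vector fields \<open>a\<close>, \<open>b\<close>, \<open>c\<close>; these commute,
  so that no Lie bracket terms occur.
\<close>

definition ext_deriv :: "'n::finite two_form \<Rightarrow>
    complex^'n \<Rightarrow> complex^'n \<Rightarrow> complex^'n \<Rightarrow> complex^'n \<Rightarrow> complex" where
  "ext_deriv \<omega> p a b c =
     frechet_derivative (\<lambda>q. \<omega> q b c) (at p) a
   - frechet_derivative (\<lambda>q. \<omega> q a c) (at p) b
   + frechet_derivative (\<lambda>q. \<omega> q a b) (at p) c"

definition symplectic_form_on :: "(complex^'n::finite) set \<Rightarrow> 'n two_form \<Rightarrow> bool" where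
  "symplectic_form_on U \<omega> \<longleftrightarrow>
     open U \<and> holomorphic_two_form_on U \<omega> \<and>
     (\<forall>p\<in>U. \<forall>a b c. ext_deriv \<omega> p a b c = 0) \<and>
     (\<forall>p\<in>U. \<forall>u. (\<forall>w. \<omega> p u w = 0) \<longrightarrow> u = 0)"


section \<open>Graphs with jump matrices and the standard two-form\<close>

text \<open>
  Both orientations of an edge are listed in \<open>oedges\<close> and exchanged by \<open>rev_edge\<close>. The list
  \<open>star G v\<close> consists of the edges at \<open>v\<close>, oriented away from \<open>v\<close>, in counterclockwise order.
  The jump matrices depend on a parameter \<open>p :: 'p\<close>. Since an infinite ray has a single end
  point, its inward orientation lies in no star.
\<close>

record ('v, 'e, 'p) jump_graph =
  verts :: "'v set"
  oedges :: "'e set"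
  rev_edge :: "'e \<Rightarrow> 'e"
  star :: "'v \<Rightarrow> 'e list"
  jump :: "'e \<Rightarrow> 'p \<Rightarrow> complex^2^2"

definition mat_prod :: "('p \<Rightarrow> complex^2^2) list \<Rightarrow> 'p \<Rightarrow> complex^2^2" where
  "mat_prod Ms p = foldr (\<lambda>M N. M p ** N) Ms (mat 1)"

definition is_jump_graph :: "'p set \<Rightarrow> ('v, 'e, 'p) jump_graph \<Rightarrow> bool" where
  "is_jump_graph U G \<longleftrightarrow>
     finite (verts G) \<and>
     (\<forall>d\<in>oedges G. rev_edge G d \<in> oedges G \<and> rev_edge G d \<noteq> d \<and>
        rev_edge G (rev_edge G d) = d) \<and>
     (\<forall>v\<in>verts G. distinct (star G v) \<and> set (star G v) \<subseteq> oedges G) \<and>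
     (\<forall>v\<in>verts G. \<forall>w\<in>verts G. v \<noteq> w \<longrightarrow> set (star G v) \<inter> set (star G w) = {}) \<and>
     (\<forall>d\<in>oedges G. \<exists>v\<in>verts G. d \<in> set (star G v) \<or> rev_edge G d \<in> set (star G v)) \<and>
     (\<forall>p\<in>U. \<forall>d\<in>oedges G. det (jump G d p) = 1 \<and>
        jump G (rev_edge G d) p = matrix_inv (jump G d p)) \<and>
     (\<forall>p\<in>U. \<forall>v\<in>verts G. mat_prod (map (jump G) (star G v)) p = mat 1)"

text \<open>The matrix-valued one-form \<open>M\<^sup>-\<^sup>1 dM\<close>.\<close>

definition log_diff :: "(complex^'n::finite \<Rightarrow> complex^2^2) \<Rightarrow>
    complex^'n \<Rightarrow> complex^'n \<Rightarrow> complex^2^2" where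
  "log_diff M p u = matrix_inv (M p) ** frechet_derivative M (at p) u"

definition trace_wedge :: "(complex^'n::finite \<Rightarrow> complex^'n \<Rightarrow> complex^2^2) \<Rightarrow>
    (complex^'n \<Rightarrow> complex^'n \<Rightarrow> complex^2^2) \<Rightarrow> 'n two_form" where
  "trace_wedge M N p u w =
     (\<Sum>i\<in>UNIV. \<Sum>j\<in>UNIV. wedge (\<lambda>q v. M q v $ i $ j) (\<lambda>q v. N q v $ j $ i) p u w)"

text \<open>As lists are indexed from zero, \<open>J\<^sub>k\<close> is the entry \<open>k - 1\<close> of the star.\<close>

definition standard_two_form :: "('v, 'e, complex^'n::finite) jump_graph \<Rightarrow> 'n two_form" where
  "standard_two_form G p u w =
     (\<Sum>v\<in>verts G. \<Sum>k=1..length (star G v) - 1.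
        trace_wedge (log_diff (mat_prod (map (jump G) (take k (star G v)))))
                    (log_diff (jump G (star G v ! (k - 1)))) p u w)"


section \<open>The graph \<open>\<Sigma>\<^sub>0\<close>\<close>

text \<open>
  Coordinates on \<open>\<complex>\<^sup>2\<^sup>K\<close> are indexed by a finite type \<open>'n\<close>, enumerated by
  \<open>e :: nat \<Rightarrow> 'n\<close>, which is meant to restrict to a bijection from \<open>{1..2 * K}\<close>:
  \<open>y\<^sub>j\<close> is \<open>y $ e j\<close>.
\<close>

definition torus :: "(complex^'n::finite) set" where
  "torus = {y. \<forall>i. y $ i \<noteq> 0}"

definition Dmat :: "complex \<Rightarrow> complex^2^2" where
  "Dmat x = vector [vector [inverse x, 0], vector [0, x]]"

definition Vmat :: "complex \<Rightarrow> complex^2^2" where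
  "Vmat x = vector [vector [0, - x], vector [inverse x, 0]]"

definition Amat :: "complex^2^2" where
  "Amat = vector [vector [0, 1], vector [-1, -1]]"

definition xcoord :: "nat \<Rightarrow> (nat \<Rightarrow> 'n::finite) \<Rightarrow> nat \<Rightarrow> complex^'n \<Rightarrow> complex" where
  "xcoord K e l y =
     (if l = 2 * K + 1 then \<Prod>j=1..2 * K. (y $ e j) powi ((-1) ^ (j + 1))
      else \<Prod>j=1..l. (y $ e j) powi ((-1) ^ (j + 1)))"

text \<open>
  \<open>Pt j\<close> is the vertex \<open>v\<^sub>j\<close> of the polygon, \<open>Ctr j\<close> is the vertex \<open>z\<^sub>j\<close> inside the triangle
  with vertices \<open>v\<^sub>j\<close>, \<open>v\<^bsub>j+1\<^esub>\<close> and \<open>v\<^bsub>2K+2\<^esub>\<close>, and \<open>End j\<close> is the point at infinity on the ray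
  from \<open>v\<^sub>j\<close>, which is not a vertex of the graph. An oriented edge is the pair of its tail and head.
\<close>

datatype node = Pt nat | Ctr nat | End nat

definition half_edges :: "nat \<Rightarrow> (node \<times> node) set" where
  "half_edges K =
     (\<lambda>j. (Pt j, Pt (j + 1))) ` {1..2 * K + 1} \<union> {(Pt (2 * K + 2), Pt 1)} \<union>
     (\<lambda>j. (Pt j, End j)) ` {1..2 * K + 2} \<union>
     (\<lambda>j. (Pt (2 * K + 2), Pt j)) ` {2..2 * K} \<union>
     (\<Union>j\<in>{1..2 * K}. {(Ctr j, Pt j), (Ctr j, Pt (j + 1)), (Ctr j, Pt (2 * K + 2))})"

text \<open>
  The outgoing edges at each vertex, given by their heads and jump matrices. \<open>inner_list\<close>
  lists the edges at \<open>v\<^sub>j\<close> other than the ray, counterclockwise and starting just after the ray;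
  \<open>out_list\<close> appends the ray, with the jump matrix that makes the product of the list trivial.
\<close>

definition inner_list :: "nat \<Rightarrow> (nat \<Rightarrow> 'n::finite) \<Rightarrow> nat \<Rightarrow>
    (node \<times> (complex^'n \<Rightarrow> complex^2^2)) list" where
  "inner_list K e i =
    (if i = 1 then
       [(Pt 2, \<lambda>y. Vmat (inverse (y $ e 1))),
        (Ctr 1, \<lambda>y. Amat),
        (Pt (2 * K + 2), \<lambda>y. matrix_inv (Dmat (y $ e 1)))]
     else if i = 2 * K + 2 then
       [(Pt 1, \<lambda>y. Dmat (y $ e 1)),
        (Ctr 1, \<lambda>y. Amat)] @
       concat (map (\<lambda>j.
         [(Pt j, \<lambda>y. if even j then Vmat (y $ e j) else matrix_inv (Vmat (y $ e j))),
          (Ctr j, \<lambda>y. Amat)]) [2..<2 * K + 1]) @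
       [(Pt (2 * K + 1), \<lambda>y. matrix_inv (Vmat (inverse (xcoord K e (2 * K + 1) y))))]
     else if i = 2 * K + 1 then
       [(Pt (2 * K + 2), \<lambda>y. Vmat (inverse (xcoord K e (2 * K + 1) y))),
        (Ctr (2 * K), \<lambda>y. Amat),
        (Pt (2 * K), \<lambda>y. matrix_inv (Dmat (xcoord K e (2 * K) y)))]
     else if even i then
       [(Pt (i + 1), \<lambda>y. Dmat (xcoord K e i y)),
        (Ctr i, \<lambda>y. Amat),
        (Pt (2 * K + 2), \<lambda>y. matrix_inv (Vmat (y $ e i))),
        (Ctr (i - 1), \<lambda>y. Amat),
        (Pt (i - 1), \<lambda>y. matrix_inv (Vmat (inverse (xcoord K e (i - 1) y))))]
     else
       [(Pt (i + 1), \<lambda>y. Vmat (inverse (xcoord K e i y))),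
        (Ctr i, \<lambda>y. Amat),
        (Pt (2 * K + 2), \<lambda>y. Vmat (y $ e i)),
        (Ctr (i - 1), \<lambda>y. Amat),
        (Pt (i - 1), \<lambda>y. matrix_inv (Dmat (xcoord K e (i - 1) y)))])"

fun out_list :: "nat \<Rightarrow> (nat \<Rightarrow> 'n::finite) \<Rightarrow> node \<Rightarrow>
    (node \<times> (complex^'n \<Rightarrow> complex^2^2)) list" where
  "out_list K e (Pt i) =
     inner_list K e i @
     [(End i, \<lambda>y. matrix_inv (mat_prod (map snd (inner_list K e i)) y))]"
| "out_list K e (Ctr j) =
     [(Pt (2 * K + 2), \<lambda>y. matrix_inv Amat),
      (Pt j, \<lambda>y. matrix_inv Amat),
      (Pt (j + 1), \<lambda>y. matrix_inv Amat)]"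
| "out_list K e (End i) = []"

fun sigma0_jump :: "nat \<Rightarrow> (nat \<Rightarrow> 'n::finite) \<Rightarrow> node \<times> node \<Rightarrow> complex^'n \<Rightarrow> complex^2^2" where
  "sigma0_jump K e (End i, b) =
     (\<lambda>y. matrix_inv (the (map_of (out_list K e b) (End i)) y))"
| "sigma0_jump K e (a, b) = the (map_of (out_list K e a) b)"

definition sigma0 :: "nat \<Rightarrow> (nat \<Rightarrow> 'n::finite) \<Rightarrow>
    (node, node \<times> node, complex^'n) jump_graph" where
  "sigma0 K e = \<lparr>
     verts = Pt ` {1..2 * K + 2} \<union> Ctr ` {1..2 * K},
     oedges = half_edges K \<union> (half_edges K)\<inverse>,
     rev_edge = prod.swap,
     star = (\<lambda>v. map (\<lambda>(b, M). (v, b)) (out_list K e v)),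
     jump = sigma0_jump K e\<rparr>"


section \<open>The graph \<open>\<Sigma>\<^sub>0\<close> satisfies the conditions on jump matrices\<close>

lemma matrix_inv_inverses:
  fixes M :: "complex^2^2"
  assumes "det M = 1"
  shows "M ** matrix_inv M = mat 1" "matrix_inv M ** M = mat 1"
proof -
  have "invertible M"
    using assms by (simp add: invertible_det_nz)
  then have "\<exists>N. M ** N = mat 1 \<and> N ** M = mat 1"
    by (simp add: invertible_def)
  then have "M ** matrix_inv M = mat 1 \<and> matrix_inv M ** M = mat 1"
    unfolding matrix_inv_def by (rule someI_ex)
  then show "M ** matrix_inv M = mat 1" "matrix_inv M ** M = mat 1"
    by auto
qed

lemma det_matrix_inv:
  fixes M :: "complex^2^2"
  assumes "det M = 1"
  shows "det (matrix_inv M) = 1"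
  using matrix_inv_inverses(1)[OF assms] assms det_mul[of M "matrix_inv M"] by simp

lemma matrix_inv_matrix_inv:
  fixes M :: "complex^2^2"
  assumes "det M = 1"
  shows "matrix_inv (matrix_inv M) = M"
proof -
  have "M = M ** (matrix_inv M ** matrix_inv (matrix_inv M))"
    using matrix_inv_inverses(1)[OF det_matrix_inv[OF assms]] by simp
  also have "\<dots> = matrix_inv (matrix_inv M)"
    using matrix_inv_inverses(1)[OF assms] by (simp add: matrix_mul_assoc)
  finally show ?thesis by simp
qed

lemma det_Dmat: "x \<noteq> 0 \<Longrightarrow> det (Dmat x) = 1"
  by (simp add: Dmat_def det_2)

lemma det_Vmat: "x \<noteq> 0 \<Longrightarrow> det (Vmat x) = 1"
  by (simp add: Vmat_def det_2)

lemma det_Amat: "det Amat = 1"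
  by (simp add: Amat_def det_2)

lemma Amat_cubed: "Amat ** Amat ** Amat = mat 1"
  by (simp add: Amat_def vec_eq_iff forall_2 matrix_matrix_mult_def sum_2 mat_def)

lemma xcoord_nonzero: "y \<in> torus \<Longrightarrow> xcoord K e l y \<noteq> 0"
  by (auto simp: torus_def xcoord_def)

lemma mat_prod_append: "mat_prod (Ms @ Ns) p = mat_prod Ms p ** mat_prod Ns p"
  by (induction Ms) (simp_all add: mat_prod_def matrix_mul_assoc)

lemma det_mat_prod: "(\<And>M. M \<in> set Ms \<Longrightarrow> det (M p) = 1) \<Longrightarrow> det (mat_prod Ms p) = 1"
  by (induction Ms) (simp_all add: mat_prod_def det_mul)

lemmas mat_det_simps = det_Dmat det_Vmat det_Amat det_matrix_inv xcoord_nonzero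

lemma det_inner_list:
  assumes "y \<in> torus" "M \<in> set (map snd (inner_list K e i))"
  shows "det (M y) = 1"
proof -
  have nz: "y $ i \<noteq> 0" for i
    using assms(1) by (simp add: torus_def)
  show ?thesis
    using assms by (auto simp: inner_list_def mat_det_simps nz split: if_splits)
qed

lemma det_mat_prod_inner_list:
  "y \<in> torus \<Longrightarrow> det (mat_prod (map snd (inner_list K e i)) y) = 1"
  by (rule det_mat_prod) (rule det_inner_list)

lemma det_out_list:
  assumes "y \<in> torus" "(b, M) \<in> set (out_list K e v)"
  shows "det (M y) = 1"
proof (cases v)
  case (Pt i)
  then show ?thesis
    using assms det_inner_list[OF assms(1), of M K e i] det_mat_prod_inner_list[OF assms(1), of K e i]
    by (force simp: det_matrix_inv)
next
  case (Ctr j)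
  then show ?thesis
    using assms by (auto simp: mat_det_simps)
next
  case (End j)
  then show ?thesis using assms by auto
qed

lemma mat_prod_out_list:
  assumes "y \<in> torus" "v \<in> verts (sigma0 K e)"
  shows "mat_prod (map snd (out_list K e v)) y = mat 1"
proof (cases v)
  case (Pt i)
  then show ?thesis
    using matrix_inv_inverses(1)[OF det_mat_prod_inner_list[OF assms(1)]]
    by (simp add: mat_prod_append) (simp add: mat_prod_def)
next
  case (Ctr j)
  have "Amat ** (Amat ** Amat) = mat 1"
    using Amat_cubed by (simp add: matrix_mul_assoc)
  then have eq: "matrix_inv Amat = Amat ** Amat"
    using matrix_inv_inverses(2)[OF det_Amat]
    by (metis matrix_mul_assoc matrix_mul_lid matrix_mul_rid)
  have "(Amat ** Amat) ** ((Amat ** Amat) ** (Amat ** Amat)) =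
      (Amat ** Amat ** Amat) ** (Amat ** Amat ** Amat)"
    by (simp add: matrix_mul_assoc)
  then show ?thesis
    using Ctr by (simp add: mat_prod_def eq Amat_cubed)
next
  case (End j)
  then show ?thesis using assms by (auto simp: sigma0_def)
qed

lemma distinct_diagonal_heads:
  "distinct (concat (map (\<lambda>j. [Pt j, Ctr j]) [a..<b]))"
  by (induction b) auto

lemma distinct_out_list:
  assumes "K \<ge> 1" "v \<in> verts (sigma0 K e)"
  shows "distinct (map fst (out_list K e v))"
proof (cases v)
  case (Pt i)
  have i: "1 \<le> i" "i \<le> 2 * K + 2"
    using assms Pt by (auto simp: sigma0_def)
  show ?thesis
  proof (cases "i = 2 * K + 2")
    case True
    have eq: "map fst (inner_list K e i) =
        [Pt 1, Ctr 1] @ concat (map (\<lambda>j. [Pt j, Ctr j]) [2..<2 * K + 1]) @ [Pt (2 * K + 1)]"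
      unfolding inner_list_def using True assms(1) by (simp add: map_concat o_def)
    have "distinct (map fst (inner_list K e i))"
      unfolding eq using assms(1) by (simp only: distinct_append distinct_diagonal_heads) auto
    moreover have "End i \<notin> set (map fst (inner_list K e i))"
      unfolding eq by auto
    ultimately show ?thesis
      using Pt by simp
  next
    case False
    then show ?thesis
      using Pt i assms(1) by (auto simp: inner_list_def)
  qed
qed (use assms in \<open>auto simp: sigma0_def\<close>)

lemma sigma0_jump_eq:
  assumes "K \<ge> 1" "v \<in> verts (sigma0 K e)" "(b, M) \<in> set (out_list K e v)"
  shows "sigma0_jump K e (v, b) = M"
  using assms(2,3) distinct_out_list[OF assms(1,2)]
  by (cases v) (auto simp: sigma0_def simp del: out_list.simps)

lemma jump_star_sigma0:
  assumes "K \<ge> 1" "v \<in> verts (sigma0 K e)"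
  shows "map (jump (sigma0 K e)) (star (sigma0 K e) v) = map snd (out_list K e v)"
  using sigma0_jump_eq[OF assms] by (auto simp: sigma0_def)

lemma polygon_edge_jumps:
  assumes "K \<ge> 1" "1 \<le> j" "j \<le> 2 * K + 1"
  obtains M where
    "(Pt (j + 1), M) \<in> set (out_list K e (Pt j))"
    "(Pt j, \<lambda>y. matrix_inv (M y)) \<in> set (out_list K e (Pt (j + 1)))"
proof -
  have "j = 1 \<or> j = 2 * K + 1 \<or> even j \<and> 2 \<le> j \<and> j \<le> 2 * K \<or> odd j \<and> 3 \<le> j \<and> j < 2 * K"
    using assms by presburger
  then consider "j = 1" | "j = 2 * K + 1" | "even j" "2 \<le> j" "j \<le> 2 * K" |
    "odd j" "3 \<le> j" "j < 2 * K"
    by blast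
  then show ?thesis
  proof cases
    case 1
    then show ?thesis
      using assms that[of "\<lambda>y. Vmat (inverse (y $ e 1))"] by (auto simp: inner_list_def xcoord_def)
  next
    case 2
    then show ?thesis
      using assms that[of "\<lambda>y. Vmat (inverse (xcoord K e (2 * K + 1) y))"]
      by (auto simp: inner_list_def)
  next
    case 3
    then show ?thesis
      using assms that[of "\<lambda>y. Dmat (xcoord K e j y)"] by (auto simp: inner_list_def)
  next
    case 4
    then show ?thesis
      using assms that[of "\<lambda>y. Vmat (inverse (xcoord K e j y))"] by (auto simp: inner_list_def)
  qed
qed

lemma last_edge_jumps:
  assumes "K \<ge> 1"
  shows "(Pt 1, \<lambda>y. Dmat (y $ e 1)) \<in> set (out_list K e (Pt (2 * K + 2)))"
    "(Pt (2 * K + 2), \<lambda>y. matrix_inv (Dmat (y $ e 1))) \<in> set (out_list K e (Pt 1))"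
  using assms by (auto simp: inner_list_def)

lemma diagonal_jumps:
  fixes e :: "nat \<Rightarrow> 'n::finite"
  assumes "2 \<le> j" "j \<le> 2 * K"
  defines "M \<equiv> \<lambda>y. if even j then Vmat (y $ e j) else matrix_inv (Vmat (y $ e j))"
  shows "(Pt j, M) \<in> set (out_list K e (Pt (2 * K + 2)))"
    "(Pt (2 * K + 2), \<lambda>y. if even j then matrix_inv (Vmat (y $ e j)) else Vmat (y $ e j))
       \<in> set (out_list K e (Pt j))"
  using assms by (auto simp: inner_list_def)

lemma spoke_jumps:
  assumes "1 \<le> j" "j \<le> 2 * K" "i = j \<or> i = j + 1 \<or> i = 2 * K + 2"
  shows "(Pt i, \<lambda>y. matrix_inv Amat) \<in> set (out_list K e (Ctr j))"
    "(Ctr j, \<lambda>y. Amat) \<in> set (out_list K e (Pt i))"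
  using assms by (auto simp: inner_list_def)

lemma half_edges_cases:
  assumes "d \<in> half_edges K"
  obtains (polygon) j where "d = (Pt j, Pt (j + 1))" "1 \<le> j" "j \<le> 2 * K + 1"
  | (last) "d = (Pt (2 * K + 2), Pt 1)"
  | (ray) j where "d = (Pt j, End j)" "1 \<le> j" "j \<le> 2 * K + 2"
  | (diagonal) j where "d = (Pt (2 * K + 2), Pt j)" "2 \<le> j" "j \<le> 2 * K"
  | (spoke) i j where "d = (Ctr j, Pt i)" "1 \<le> j" "j \<le> 2 * K" "i = j \<or> i = j + 1 \<or> i = 2 * K + 2"
  using assms unfolding half_edges_def by (auto 0 3)

lemma half_edge_jump:
  assumes "K \<ge> 1" "y \<in> torus" "(a, b) \<in> half_edges K"
  shows "a \<in> verts (sigma0 K e)" "b \<in> fst ` set (out_list K e a)"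
    "det (sigma0_jump K e (a, b) y) = 1"
    "sigma0_jump K e (b, a) y = matrix_inv (sigma0_jump K e (a, b) y)"
proof -
  have *: "a \<in> verts (sigma0 K e) \<and> b \<in> fst ` set (out_list K e a) \<and>
    det (sigma0_jump K e (a, b) y) = 1 \<and>
    sigma0_jump K e (b, a) y = matrix_inv (sigma0_jump K e (a, b) y)"
    if "a \<in> verts (sigma0 K e)" "b \<in> verts (sigma0 K e)"
      "(b, M) \<in> set (out_list K e a)" "(a, N) \<in> set (out_list K e b)"
      "N y = matrix_inv (M y)" for M N
    unfolding sigma0_jump_eq[OF assms(1) that(1,3)] sigma0_jump_eq[OF assms(1) that(2,4)]
    using that det_out_list[OF assms(2) that(3)] by (auto intro: image_eqI[rotated, OF that(3)])
  have nz: "y $ i \<noteq> 0" for i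
    using assms(2) by (simp add: torus_def)
  have "a \<in> verts (sigma0 K e) \<and> b \<in> fst ` set (out_list K e a) \<and>
    det (sigma0_jump K e (a, b) y) = 1 \<and>
    sigma0_jump K e (b, a) y = matrix_inv (sigma0_jump K e (a, b) y)"
    using assms(3)
  proof (cases rule: half_edges_cases)
    case (polygon j)
    obtain M where M: "(Pt (j + 1), M) \<in> set (out_list K e (Pt j))"
      "(Pt j, \<lambda>y. matrix_inv (M y)) \<in> set (out_list K e (Pt (j + 1)))"
      using polygon_edge_jumps[OF assms(1) polygon(2,3)] by blast
    have ab: "a = Pt j" "b = Pt (j + 1)"
      using polygon by auto
    show ?thesis
      by (rule *[OF _ _ M[folded ab]]) (use polygon ab in \<open>auto simp: sigma0_def\<close>)
  next
    case last
    then have ab: "a = Pt (2 * K + 2)" "b = Pt 1"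
      by auto
    show ?thesis
      by (rule *[OF _ _ last_edge_jumps[OF assms(1), folded ab]]) (auto simp: ab sigma0_def)
  next
    case (ray j)
    then have ab: "a = Pt j" "b = End j"
      by auto
    obtain M where M: "(b, M) \<in> set (out_list K e a)"
      unfolding ab by auto
    have v: "a \<in> verts (sigma0 K e)"
      using ray ab by (auto simp: sigma0_def)
    have "sigma0_jump K e (b, a) y = matrix_inv (sigma0_jump K e (a, b) y)"
      by (simp add: ab)
    moreover have "det (sigma0_jump K e (a, b) y) = 1"
      unfolding sigma0_jump_eq[OF assms(1) v M] by (rule det_out_list[OF assms(2) M])
    moreover have "b \<in> fst ` set (out_list K e a)"
      using M by (rule image_eqI[rotated]) simp
    ultimately show ?thesis
      using v by blast
  next
    case (diagonal j)
    then have ab: "a = Pt (2 * K + 2)" "b = Pt j"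
      by auto
    show ?thesis
      by (rule *[OF _ _ diagonal_jumps[OF diagonal(2,3), folded ab]])
        (use diagonal ab nz in \<open>auto simp: sigma0_def matrix_inv_matrix_inv det_Vmat\<close>)
  next
    case (spoke i j)
    then have ab: "a = Ctr j" "b = Pt i"
      by auto
    show ?thesis
      by (rule *[OF _ _ spoke_jumps[OF spoke(2-4), folded ab]])
        (use spoke ab in \<open>auto simp: sigma0_def matrix_inv_matrix_inv det_Amat\<close>)
  qed
  then show "a \<in> verts (sigma0 K e)" "b \<in> fst ` set (out_list K e a)"
    "det (sigma0_jump K e (a, b) y) = 1"
    "sigma0_jump K e (b, a) y = matrix_inv (sigma0_jump K e (a, b) y)"
    by auto
qed

lemma out_list_edges:
  assumes "K \<ge> 1" "v \<in> verts (sigma0 K e)" "b \<in> fst ` set (out_list K e v)"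
  shows "(v, b) \<in> half_edges K \<or> (b, v) \<in> half_edges K"
proof -
  have polygon: "(Pt j, Pt i) \<in> half_edges K" if "i = Suc j" "1 \<le> j" "j \<le> 2 * K + 1" for i j
    using that by (auto simp: half_edges_def)
  have others: "(Pt (2 * K + 2), Pt 1) \<in> half_edges K"
    "\<And>j. 1 \<le> j \<Longrightarrow> j \<le> 2 * K + 2 \<Longrightarrow> (Pt j, End j) \<in> half_edges K"
    "\<And>j. 2 \<le> j \<Longrightarrow> j \<le> 2 * K \<Longrightarrow> (Pt (2 * K + 2), Pt j) \<in> half_edges K"
    "\<And>i j. 1 \<le> j \<Longrightarrow> j \<le> 2 * K \<Longrightarrow> i = j \<or> i = Suc j \<or> i = 2 * K + 2 \<Longrightarrow>
       (Ctr j, Pt i) \<in> half_edges K"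
    by (auto simp: half_edges_def)
  note simps = polygon others
  show ?thesis
  proof (cases v)
    case (Pt i)
    have i: "1 \<le> i" "i \<le> 2 * K + 2"
      using assms(2) Pt by (auto simp: sigma0_def)
    have "b = End i \<or> b \<in> fst ` set (inner_list K e i)"
      using assms(3) Pt by auto
    then show ?thesis
    proof
      assume "b = End i"
      then show ?thesis using Pt i others(2) by auto
    next
      assume b: "b \<in> fst ` set (inner_list K e i)"
      consider "i = 1" | "i = 2 * K + 2" | "i = 2 * K + 1" | "2 \<le> i" "i \<le> 2 * K"
        using i by linarith
      then show ?thesis
      proof cases
        case 1
        then show ?thesis
          using b Pt assms(1) others(1) polygon[of 2 1] others(4)[of 1 1]
          by (auto simp: inner_list_def)
      next
        case 2
        then have "b = Pt 1 \<or> b = Ctr 1 \<or> (\<exists>j\<in>{2..2 * K}. b = Pt j \<or> b = Ctr j) \<or> b = Pt (2 * K + 1)"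
          using b assms(1) by (auto simp: inner_list_def)
        then show ?thesis
          using 2 Pt assms(1) others(1) others(3) others(4)[of _ "2 * K + 2"]
            polygon[of "2 * K + 2" "2 * K + 1"]
          by auto
      next
        case 3
        then show ?thesis
          using b Pt assms(1) polygon[of "2 * K + 2" "2 * K + 1"] polygon[of "2 * K + 1" "2 * K"]
            others(4)[of "2 * K" "2 * K + 1"]
          by (auto simp: inner_list_def)
      next
        case 4
        then have "b = Pt (i + 1) \<or> b = Ctr i \<or> b = Pt (2 * K + 2) \<or> b = Ctr (i - 1) \<or> b = Pt (i - 1)"
          using b by (auto simp: inner_list_def split: if_splits)
        moreover obtain k where k: "i = Suc k" "1 \<le> k" "k \<le> 2 * K"
          using 4 by (cases i) auto
        ultimately show ?thesis
          using 4 Pt k polygon[of "i + 1" i] polygon[of i k] others(3)[of i]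
            others(4)[of i i] others(4)[of k i]
          by auto
      qed
    qed
  next
    case (Ctr j)
    then show ?thesis
      using assms others(4)[of j] by (auto simp: sigma0_def)
  next
    case (End j)
    then show ?thesis using assms by auto
  qed
qed

theorem sigma0_is_jump_graph:
  fixes e :: "nat \<Rightarrow> 'n::finite"
  assumes "K \<ge> 1"
  shows "is_jump_graph torus (sigma0 K e)"
proof -
  let ?G = "sigma0 K e"
  have star: "set (star ?G v) = Pair v ` fst ` set (out_list K e v)" for v
    by (force simp: sigma0_def)
  have edges: "oedges ?G = half_edges K \<union> (half_edges K)\<inverse>" "rev_edge ?G = prod.swap"
    "jump ?G = sigma0_jump K e"
    by (simp_all add: sigma0_def)
  define y0 :: "complex^'n" where "y0 = (\<chi> i. 1)"
  have y0: "y0 \<in> torus"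
    by (simp add: torus_def y0_def)
  have 1: "finite (verts ?G)"
    by (simp add: sigma0_def)
  have irrefl: "a \<noteq> b" if "(a, b) \<in> half_edges K" for a b
    using that assms by (auto simp: half_edges_def)
  have 2: "rev_edge ?G d \<in> oedges ?G \<and> rev_edge ?G d \<noteq> d \<and> rev_edge ?G (rev_edge ?G d) = d"
    if "d \<in> oedges ?G" for d
  proof (cases d)
    case (Pair a b)
    then show ?thesis
      using that irrefl[of a b] irrefl[of b a] by (auto simp: edges)
  qed
  have 3: "distinct (star ?G v) \<and> set (star ?G v) \<subseteq> oedges ?G" if v: "v \<in> verts ?G" for v
  proof
    have "star ?G v = map (Pair v) (map fst (out_list K e v))"
      by (auto simp: sigma0_def)
    then show "distinct (star ?G v)"
      using distinct_out_list[OF assms v] by (simp add: distinct_map inj_on_def)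
    show "set (star ?G v) \<subseteq> oedges ?G"
      using out_list_edges[OF assms v] by (auto simp: star edges simp del: out_list.simps)
  qed
  have 4: "set (star ?G v) \<inter> set (star ?G w) = {}" if "v \<noteq> w" for v w
    using that by (auto simp: star)
  have 5: "\<exists>v\<in>verts ?G. d \<in> set (star ?G v) \<or> rev_edge ?G d \<in> set (star ?G v)"
    if d: "d \<in> oedges ?G" for d
  proof (cases d)
    case (Pair a b)
    then consider "(a, b) \<in> half_edges K" | "(b, a) \<in> half_edges K"
      using d by (auto simp: edges)
    then show ?thesis
    proof cases
      case 1
      then show ?thesis
        using half_edge_jump(1,2)[OF assms y0 1, of e] unfolding Pair star by blast
    next
      case 2
      then show ?thesis
        using half_edge_jump(1,2)[OF assms y0 2, of e] unfolding Pair star edges by auto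
    qed
  qed
  have 6: "det (jump ?G d y) = 1 \<and> jump ?G (rev_edge ?G d) y = matrix_inv (jump ?G d y)"
    if y: "y \<in> torus" and d: "d \<in> oedges ?G" for d y
  proof (cases d)
    case (Pair a b)
    then consider "(a, b) \<in> half_edges K" | "(b, a) \<in> half_edges K"
      using d by (auto simp: edges)
    then show ?thesis
    proof cases
      case 1
      then show ?thesis
        using half_edge_jump(3,4)[OF assms y 1, of e] by (simp add: Pair edges)
    next
      case 2
      then show ?thesis
        using half_edge_jump(3,4)[OF assms y 2, of e]
        by (simp add: Pair edges det_matrix_inv matrix_inv_matrix_inv)
    qed
  qed
  have 7: "mat_prod (map (jump ?G) (star ?G v)) y = mat 1" if "y \<in> torus" "v \<in> verts ?G" for v y
    unfolding jump_star_sigma0[OF assms that(2)] by (rule mat_prod_out_list[OF that])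
  show ?thesis
    unfolding is_jump_graph_def by (intro conjI ballI impI) (simp_all only: 1 2 3 4 5 6 7 simp_thms)
qed

end

theory Submission
  imports Defs
begin

text \<open>
  Every jump matrix is constant or satisfies \<open>J\<^sup>-\<^sup>1 dJ = diag(- d log x, d log x)\<close>, so the
  trace only sees the diagonal part of \<open>P\<^sup>-\<^sup>1 dP\<close> for the partial products \<open>P\<close>. As \<open>A V(x)\<close>
  is lower and \<open>V(x) A\<close> upper triangular, these products stay triangular when the letters at a
  vertex are grouped suitably, and the diagonal of \<open>P\<^sup>-\<^sup>1 dP\<close> is a signed sum of the forms
  \<open>d log x\<close> collected so far. This gives each vertex contribution as a combination of
  \<open>d log y\<^sub>i \<and> d log y\<^sub>j\<close>, and for \<open>i < j\<close> the coefficients add up to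
  \<open>2 (1 + (-1)\<^sup>j) (1 - (-1)\<^sup>i)\<close>.
\<close>

section \<open>Two-by-two matrices of determinant one and their inverses\<close>

lemma mat2_eqI:
  fixes M N :: "'a^2^2"
  assumes "M $ 1 $ 1 = N $ 1 $ 1" "M $ 1 $ 2 = N $ 1 $ 2"
    "M $ 2 $ 1 = N $ 2 $ 1" "M $ 2 $ 2 = N $ 2 $ 2"
  shows "M = N"
  using assms by (simp add: vec_eq_iff forall_2)

lemma matrix_mult_2_nth:
  fixes M N :: "complex^2^2"
  shows "(M ** N) $ i $ j = M $ i $ 1 * N $ 1 $ j + M $ i $ 2 * N $ 2 $ j"
  by (simp add: matrix_matrix_mult_def sum_2)

text \<open>\<open>matrix_inv\<close> is given by a choice, so the adjugate has to be identified
  with it: it is a right inverse of \<open>M\<close>, and multiplying by \<open>matrix_inv M\<close>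
  from the left turns it into the chosen one.\<close>

lemma matrix_inv_2:
  fixes M :: "complex^2^2"
  assumes "det M = 1"
  shows "matrix_inv M = vector [vector [M $ 2 $ 2, - M $ 1 $ 2], vector [- M $ 2 $ 1, M $ 1 $ 1]]"
    (is "_ = ?N")
proof -
  have "M ** ?N = mat 1"
    using assms by (intro mat2_eqI) (auto simp: matrix_mult_2_nth mat_def det_2 algebra_simps)
  then have "matrix_inv M ** (M ** ?N) = matrix_inv M"
    by simp
  then show ?thesis
    by (simp add: matrix_mul_assoc matrix_inv_inverses[OF assms])
qed

lemma matrix_inv_Dmat: "x \<noteq> 0 \<Longrightarrow> matrix_inv (Dmat x) = Dmat (inverse x)"
  using matrix_inv_2[OF det_Dmat, of x] by (simp add: Dmat_def)

lemma matrix_inv_Vmat: "x \<noteq> 0 \<Longrightarrow> matrix_inv (Vmat x) = Vmat (- x)"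
  using matrix_inv_2[OF det_Vmat, of x] by (simp add: Vmat_def)

lemma matrix_inv_Amat: "matrix_inv Amat = vector [vector [-1, -1], vector [1, 0]]"
  using matrix_inv_2[OF det_Amat] by (simp add: Amat_def)

section \<open>Logarithmic derivatives\<close>

text \<open>Writing df as \<zeta> f instead of dividing by f, with nonvanishing built in, lets
  products add the \<zeta> and inverses negate it.\<close>

definition has_dlog ::
    "(complex^'n::finite \<Rightarrow> complex) \<Rightarrow> complex^'n \<Rightarrow> (complex^'n \<Rightarrow> complex) \<Rightarrow> bool" where
  "has_dlog f p \<zeta> \<longleftrightarrow> f p \<noteq> 0 \<and> (f has_derivative (\<lambda>u. \<zeta> u * f p)) (at p)"

lemma has_dlog_imp_dlog: "has_dlog f p \<zeta> \<Longrightarrow> dlog f p u = \<zeta> u"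
  unfolding has_dlog_def dlog_def using frechet_derivative_at[of f _ p]
  by (metis nonzero_mult_div_cancel_right)

lemma has_dlog_const: "c \<noteq> 0 \<Longrightarrow> has_dlog (\<lambda>_. c) p (\<lambda>_. 0)"
  by (simp add: has_dlog_def)

lemma has_dlog_coord: "p $ i \<noteq> 0 \<Longrightarrow> has_dlog (\<lambda>y. y $ i) p (\<lambda>u. u $ i / p $ i)"
  by (simp add: has_dlog_def bounded_linear_imp_has_derivative bounded_linear_vec_nth)

lemma has_dlog_inverse:
  assumes "has_dlog f p \<zeta>"
  shows "has_dlog (\<lambda>y. inverse (f y)) p (\<lambda>u. - \<zeta> u)"
proof -
  have f: "f p \<noteq> 0" "(f has_derivative (\<lambda>u. \<zeta> u * f p)) (at p)"
    using assms by (auto simp: has_dlog_def)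
  have "- (inverse (f p) * (\<zeta> u * f p) * inverse (f p)) = - \<zeta> u * inverse (f p)" for u
    using f(1) by (simp add: field_simps)
  with Deriv.has_derivative_inverse[OF f] show ?thesis
    using f(1) by (simp add: has_dlog_def)
qed

lemma has_dlog_minus: "has_dlog f p \<zeta> \<Longrightarrow> has_dlog (\<lambda>y. - f y) p \<zeta>"
  using has_derivative_minus[of f] by (auto simp: has_dlog_def)

lemma has_dlog_mult:
  assumes "has_dlog f p \<zeta>" "has_dlog g p \<xi>"
  shows "has_dlog (\<lambda>y. f y * g y) p (\<lambda>u. \<zeta> u + \<xi> u)"
proof -
  have "((\<lambda>y. f y * g y) has_derivative (\<lambda>u. f p * (\<xi> u * g p) + \<zeta> u * f p * g p)) (at p)"
    using assms unfolding has_dlog_def by (intro has_derivative_mult) auto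
  then show ?thesis
    using assms by (simp add: has_dlog_def algebra_simps)
qed

lemma has_dlog_prod:
  assumes "finite I" "\<And>i. i \<in> I \<Longrightarrow> has_dlog (f i) p (\<zeta> i)"
  shows "has_dlog (\<lambda>y. \<Prod>i\<in>I. f i y) p (\<lambda>u. \<Sum>i\<in>I. \<zeta> i u)"
  using assms by (induction I) (auto intro: has_dlog_const has_dlog_mult)

text \<open>Continuity at \<open>p\<close> and \<open>f p\<close> \<noteq> 0 give this. The filter
  \<open>at p\<close> leaves out \<open>p\<close> itself, hence the separate condition
  \<open>M p = N p\<close> in \<open>has_log_deriv_transform\<close>.\<close>

lemma has_dlog_eventually_nonzero:
  assumes "has_dlog f p \<zeta>"
  shows "\<forall>\<^sub>F y in at p. f y \<noteq> 0"
proof -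
  have "continuous (at p) f"
    using assms has_derivative_continuous unfolding has_dlog_def by blast
  then show ?thesis
    using assms tendsto_imp_eventually_ne unfolding has_dlog_def continuous_at by blast
qed

text \<open>\<open>L\<close> is M^-1 dM, put as dM = M L so that no inverse needs to be
  differentiated; determinant one makes \<open>matrix_inv (M p)\<close> a true inverse.\<close>

definition has_log_deriv ::
    "(complex^'n::finite \<Rightarrow> complex^2^2) \<Rightarrow> complex^'n \<Rightarrow> (complex^'n \<Rightarrow> complex^2^2) \<Rightarrow> bool" where
  "has_log_deriv M p L \<longleftrightarrow> det (M p) = 1 \<and> (M has_derivative (\<lambda>u. M p ** L u)) (at p)"

lemma has_log_deriv_imp_log_diff:
  assumes "has_log_deriv M p L"
  shows "log_diff M p u = L u"
proof -
  have "frechet_derivative M (at p) = (\<lambda>u. M p ** L u)"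
    using assms frechet_derivative_at unfolding has_log_deriv_def by metis
  then show ?thesis
    using assms matrix_inv_inverses(2)[of "M p"]
    by (simp add: log_diff_def has_log_deriv_def matrix_mul_assoc)
qed

lemma has_log_deriv_transform:
  assumes "has_log_deriv M p L" "\<forall>\<^sub>F y in at p. M y = N y" "M p = N p"
  shows "has_log_deriv N p L"
  using assms has_derivative_transform_eventually[OF _ assms(2,3)]
  by (auto simp: has_log_deriv_def)

lemma has_log_deriv_const: "det C = 1 \<Longrightarrow> has_log_deriv (\<lambda>_. C) p (\<lambda>_. 0)"
  by (simp add: has_log_deriv_def)

lemma bounded_bilinear_matrix_mult:
  "bounded_bilinear ((**) :: complex^2^2 \<Rightarrow> complex^2^2 \<Rightarrow> complex^2^2)"
  unfolding bilinear_conv_bounded_bilinear[symmetric] bilinear_def linear_iff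
  by (simp add: vec_eq_iff matrix_mult_2_nth algebra_simps)

text \<open>Leibniz rule: factoring M N out of (dM) N + M dN on the left conjugates the logarithmic
  derivative of M by N and leaves that of N alone.\<close>

lemma has_log_deriv_mult:
  assumes "has_log_deriv M p L" "has_log_deriv N p L'"
  shows "has_log_deriv (\<lambda>y. M y ** N y) p (\<lambda>u. matrix_inv (N p) ** L u ** N p + L' u)"
proof -
  have "((\<lambda>y. M y ** N y) has_derivative (\<lambda>u. M p ** (N p ** L' u) + (M p ** L u) ** N p)) (at p)"
    using assms unfolding has_log_deriv_def
    by (intro bounded_bilinear.FDERIV[OF bounded_bilinear_matrix_mult]) auto
  moreover have inv: "N p ** (matrix_inv (N p) ** X) = X" for X
    using matrix_inv_inverses(1)[of "N p"] assms(2)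
    by (simp add: has_log_deriv_def matrix_mul_assoc)
  have "M p ** (N p ** L' u) + (M p ** L u) ** N p =
      (M p ** N p) ** (matrix_inv (N p) ** L u ** N p + L' u)" for u
    by (simp add: matrix_add_ldistrib add.commute inv flip: matrix_mul_assoc)
  ultimately show ?thesis
    using assms by (simp add: has_log_deriv_def det_mul)
qed

text \<open>The matrix is the image of the quadruple of its entries under a linear map, which is
  bounded by finite dimension.\<close>

lemma has_derivative_matrix2:
  fixes a b c d :: "'a::real_normed_vector \<Rightarrow> complex"
  assumes "(a has_derivative a') (at x within S)" "(b has_derivative b') (at x within S)"
    "(c has_derivative c') (at x within S)" "(d has_derivative d') (at x within S)"
  shows "((\<lambda>y. vector [vector [a y, b y], vector [c y, d y]] :: complex^2^2) has_derivative
    (\<lambda>u. vector [vector [a' u, b' u], vector [c' u, d' u]])) (at x within S)"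
proof -
  have "linear (\<lambda>(a, b, c, d). vector [vector [a, b], vector [c, d]] :: complex^2^2)"
    by (auto simp: linear_iff vec_eq_iff forall_2)
  then have "bounded_linear (\<lambda>(a, b, c, d). vector [vector [a, b], vector [c, d]] :: complex^2^2)"
    by (simp add: linear_conv_bounded_linear)
  from bounded_linear.has_derivative[OF this, OF has_derivative_Pair[OF assms(1)
      has_derivative_Pair[OF assms(2) has_derivative_Pair[OF assms(3,4)]]]]
  show ?thesis
    by simp
qed

definition diag_log :: "('a \<Rightarrow> complex) \<Rightarrow> 'a \<Rightarrow> complex^2^2" where
  "diag_log \<zeta> u = vector [vector [- \<zeta> u, 0], vector [0, \<zeta> u]]"

lemma has_log_deriv_Dmat:
  assumes "has_dlog f p \<zeta>"
  shows "has_log_deriv (\<lambda>y. Dmat (f y)) p (diag_log \<zeta>)"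
proof -
  have f: "f p \<noteq> 0" "(f has_derivative (\<lambda>u. \<zeta> u * f p)) (at p)"
    "((\<lambda>y. inverse (f y)) has_derivative (\<lambda>u. - \<zeta> u * inverse (f p))) (at p)"
    using assms has_dlog_inverse[OF assms] by (auto simp: has_dlog_def)
  have "((\<lambda>y. Dmat (f y)) has_derivative
      (\<lambda>u. vector [vector [- \<zeta> u * inverse (f p), 0], vector [0, \<zeta> u * f p]])) (at p)"
    unfolding Dmat_def by (intro has_derivative_matrix2 f has_derivative_const)
  moreover have "vector [vector [- \<zeta> u * inverse (f p), 0], vector [0, \<zeta> u * f p]] =
      Dmat (f p) ** diag_log \<zeta> u" for u
    by (rule mat2_eqI) (simp_all add: Dmat_def diag_log_def matrix_mult_2_nth)
  ultimately show ?thesis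
    using f by (simp add: has_log_deriv_def det_Dmat)
qed

text \<open>Since \<open>Vmat x = Vmat 1 ** Dmat x\<close> for nonzero x and a constant left factor
  drops out of M^-1 dM, the result agrees with that for \<open>Dmat\<close>.\<close>

lemma has_log_deriv_Vmat:
  assumes "has_dlog f p \<zeta>"
  shows "has_log_deriv (\<lambda>y. Vmat (f y)) p (diag_log \<zeta>)"
proof -
  have f: "f p \<noteq> 0" "((\<lambda>y. - f y) has_derivative (\<lambda>u. - (\<zeta> u * f p))) (at p)"
    "((\<lambda>y. inverse (f y)) has_derivative (\<lambda>u. - \<zeta> u * inverse (f p))) (at p)"
    using assms has_dlog_inverse[OF assms] by (auto simp: has_dlog_def intro: has_derivative_minus)
  have "((\<lambda>y. Vmat (f y)) has_derivative
      (\<lambda>u. vector [vector [0, - (\<zeta> u * f p)], vector [- \<zeta> u * inverse (f p), 0]])) (at p)"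
    unfolding Vmat_def by (intro has_derivative_matrix2 f has_derivative_const)
  moreover have "vector [vector [0, - (\<zeta> u * f p)], vector [- \<zeta> u * inverse (f p), 0]] =
      Vmat (f p) ** diag_log \<zeta> u" for u
    by (rule mat2_eqI) (simp_all add: Vmat_def diag_log_def matrix_mult_2_nth)
  ultimately show ?thesis
    using f by (simp add: has_log_deriv_def det_Vmat)
qed

section \<open>The contribution of a vertex\<close>

text \<open>Only the shape of \<open>J\<close> at the base point is recorded: conjugating earlier
  logarithmic derivatives uses no other value of \<open>J\<close>. Jumps and inverse jumps can thus
  be treated alike.\<close>

definition diagonal_jump ::
    "(complex^'n::finite \<Rightarrow> complex^2^2) \<Rightarrow> complex^'n \<Rightarrow> (complex^'n \<Rightarrow> complex) \<Rightarrow> bool" where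
  "diagonal_jump J p \<zeta> \<longleftrightarrow> has_log_deriv J p (diag_log \<zeta>) \<and> (\<exists>x. x \<noteq> 0 \<and> J p = Dmat x)"

definition antidiagonal_jump ::
    "(complex^'n::finite \<Rightarrow> complex^2^2) \<Rightarrow> complex^'n \<Rightarrow> (complex^'n \<Rightarrow> complex) \<Rightarrow> bool" where
  "antidiagonal_jump J p \<zeta> \<longleftrightarrow> has_log_deriv J p (diag_log \<zeta>) \<and> (\<exists>x. x \<noteq> 0 \<and> J p = Vmat x)"

lemma diagonal_jump_Dmat: "has_dlog f p \<zeta> \<Longrightarrow> diagonal_jump (\<lambda>y. Dmat (f y)) p \<zeta>"
  using has_log_deriv_Dmat by (auto simp: diagonal_jump_def has_dlog_def)

lemma antidiagonal_jump_Vmat: "has_dlog f p \<zeta> \<Longrightarrow> antidiagonal_jump (\<lambda>y. Vmat (f y)) p \<zeta>"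
  using has_log_deriv_Vmat by (auto simp: antidiagonal_jump_def has_dlog_def)

text \<open>\<open>matrix_inv (Dmat 0)\<close> is unspecified, so the inverses are only computed near \<open>p\<close>.\<close>

lemma diagonal_jump_inv_Dmat:
  assumes "has_dlog f p \<zeta>"
  shows "diagonal_jump (\<lambda>y. matrix_inv (Dmat (f y))) p (\<lambda>u. - \<zeta> u)"
proof -
  have "\<forall>\<^sub>F y in at p. Dmat (inverse (f y)) = matrix_inv (Dmat (f y))"
    using has_dlog_eventually_nonzero[OF assms] by eventually_elim (simp add: matrix_inv_Dmat)
  moreover have eq: "Dmat (inverse (f p)) = matrix_inv (Dmat (f p))" and "f p \<noteq> 0"
    using assms by (auto simp: has_dlog_def matrix_inv_Dmat)
  ultimately have "has_log_deriv (\<lambda>y. matrix_inv (Dmat (f y))) p (diag_log (\<lambda>u. - \<zeta> u))"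
    by (intro has_log_deriv_transform[OF has_log_deriv_Dmat[OF has_dlog_inverse[OF assms]]])
  then show ?thesis
    using eq \<open>f p \<noteq> 0\<close> unfolding diagonal_jump_def by (intro conjI exI[of _ "inverse (f p)"]) auto
qed

text \<open>Inverting V only changes the sign of its parameter, which d log does not see; so \<zeta>
  is kept here but negated for the diagonal jump.\<close>

lemma antidiagonal_jump_inv_Vmat:
  assumes "has_dlog f p \<zeta>"
  shows "antidiagonal_jump (\<lambda>y. matrix_inv (Vmat (f y))) p \<zeta>"
proof -
  have "\<forall>\<^sub>F y in at p. Vmat (- f y) = matrix_inv (Vmat (f y))"
    using has_dlog_eventually_nonzero[OF assms] by eventually_elim (simp add: matrix_inv_Vmat)
  moreover have eq: "Vmat (- f p) = matrix_inv (Vmat (f p))" and "f p \<noteq> 0"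
    using assms by (auto simp: has_dlog_def matrix_inv_Vmat)
  ultimately have "has_log_deriv (\<lambda>y. matrix_inv (Vmat (f y))) p (diag_log \<zeta>)"
    by (intro has_log_deriv_transform[OF has_log_deriv_Vmat[OF has_dlog_minus[OF assms]]])
  then show ?thesis
    using eq \<open>f p \<noteq> 0\<close> unfolding antidiagonal_jump_def by (intro conjI exI[of _ "- f p"]) auto
qed

section \<open>The trace form accumulated along a list of jumps\<close>

abbreviation wedge_at :: "('a \<Rightarrow> complex) \<Rightarrow> ('a \<Rightarrow> complex) \<Rightarrow> 'a \<Rightarrow> 'a \<Rightarrow> complex" where
  "wedge_at \<alpha> \<beta> u w \<equiv> \<alpha> u * \<beta> w - \<alpha> w * \<beta> u"

text \<open>The sum includes the last index because the list will be a star without its final edge;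
  this matches the bound n - 1 in \<open>standard_two_form\<close>.\<close>

definition vertex_form :: "(complex^'n::finite \<Rightarrow> complex^2^2) list \<Rightarrow> 'n two_form" where
  "vertex_form Ms p u w =
     (\<Sum>k=1..length Ms. trace_wedge (log_diff (mat_prod (take k Ms))) (log_diff (Ms ! (k - 1))) p u w)"

lemma vertex_form_Nil: "vertex_form [] p u w = 0"
  by (simp add: vertex_form_def)

lemma vertex_form_snoc:
  "vertex_form (Ms @ [M]) p u w =
     vertex_form Ms p u w + trace_wedge (log_diff (mat_prod (Ms @ [M]))) (log_diff M) p u w"
  by (auto simp: vertex_form_def nth_append intro!: sum.cong)

lemma mat_prod_snoc: "mat_prod (Ms @ [M]) = (\<lambda>y. mat_prod Ms y ** M y)"
  unfolding fun_eq_iff mat_prod_append by (simp add: mat_prod_def)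

lemma has_log_deriv_mat_prod_snoc:
  assumes "has_log_deriv (mat_prod Ms) p L" "has_log_deriv M p L'"
  shows "has_log_deriv (mat_prod (Ms @ [M])) p (\<lambda>u. matrix_inv (M p) ** L u ** M p + L' u)"
  unfolding mat_prod_snoc using assms by (rule has_log_deriv_mult)

text \<open>Against a diagonal second factor only the diagonal of the first survives, with opposite
  signs. This is why it suffices to follow the diagonal of the partial products.\<close>

lemma trace_wedge_diag:
  assumes "\<And>u. log_diff N p u = diag_log \<zeta> u"
  shows "trace_wedge M (log_diff N) p u w =
    wedge_at (\<lambda>u. M p u $ 2 $ 2 - M p u $ 1 $ 1) \<zeta> u w"
  by (simp add: trace_wedge_def sum_2 wedge_def assms diag_log_def algebra_simps)

lemma trace_wedge_zero:
  assumes "\<And>u. log_diff N p u = 0"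
  shows "trace_wedge M (log_diff N) p u w = 0"
  by (simp add: trace_wedge_def sum_2 wedge_def assms)

text \<open>
  In the following predicates \<open>\<alpha>\<close> is the upper left entry of the logarithmic derivative of the
  product of the jump matrices listed so far, and \<open>\<Phi>\<close> is their accumulated contribution to the
  standard two-form.
\<close>

definition lower_log ::
    "(complex^'n::finite \<Rightarrow> complex^2^2) \<Rightarrow> complex^'n \<Rightarrow> (complex^'n \<Rightarrow> complex) \<Rightarrow> bool" where
  "lower_log P p \<alpha> \<longleftrightarrow> (\<exists>L. has_log_deriv P p L \<and>
     (\<forall>u. L u $ 1 $ 1 = \<alpha> u \<and> L u $ 2 $ 2 = - \<alpha> u \<and> L u $ 1 $ 2 = 0))"

definition upper_log ::
    "(complex^'n::finite \<Rightarrow> complex^2^2) \<Rightarrow> complex^'n \<Rightarrow> (complex^'n \<Rightarrow> complex) \<Rightarrow> bool" where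
  "upper_log P p \<alpha> \<longleftrightarrow> (\<exists>L. has_log_deriv P p L \<and>
     (\<forall>u. L u $ 1 $ 1 = \<alpha> u \<and> L u $ 2 $ 2 = - \<alpha> u \<and> L u $ 2 $ 1 = 0))"

definition lower_vertex where
  "lower_vertex Ms p \<alpha> \<Phi> \<longleftrightarrow> lower_log (mat_prod Ms) p \<alpha> \<and> (\<forall>u w. vertex_form Ms p u w = \<Phi> u w)"

definition upper_vertex where
  "upper_vertex Ms p \<alpha> \<Phi> \<longleftrightarrow> upper_log (mat_prod Ms) p \<alpha> \<and> (\<forall>u w. vertex_form Ms p u w = \<Phi> u w)"

lemma has_log_deriv_mat_prod_Nil: "has_log_deriv (mat_prod []) p (\<lambda>_. 0)"
  using has_log_deriv_const[of "mat 1" p] by (simp add: mat_prod_def [abs_def])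

lemma lower_vertex_Nil: "lower_vertex [] p (\<lambda>_. 0) (\<lambda>_ _. 0)"
  using has_log_deriv_mat_prod_Nil
  by (force simp: lower_vertex_def lower_log_def vertex_form_Nil)

lemma upper_vertex_Nil: "upper_vertex [] p (\<lambda>_. 0) (\<lambda>_ _. 0)"
  using has_log_deriv_mat_prod_Nil
  by (force simp: upper_vertex_def upper_log_def vertex_form_Nil)

text \<open>Conjugation by a diagonal matrix keeps the diagonal and the triangular shape, so
  \<alpha> changes by -\<zeta>. The new term is -2 (\<alpha> - \<zeta>) wedge \<zeta>, where \<zeta>
  wedge \<zeta> vanishes.\<close>

lemma lower_vertex_D:
  assumes "lower_vertex Ms p \<alpha> \<Phi>" "diagonal_jump J p \<zeta>"
  shows "lower_vertex (Ms @ [J]) p (\<lambda>u. \<alpha> u - \<zeta> u) (\<lambda>u w. \<Phi> u w - 2 * wedge_at \<alpha> \<zeta> u w)"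
proof -
  obtain L where L: "has_log_deriv (mat_prod Ms) p L"
    "\<And>u. L u $ 1 $ 1 = \<alpha> u \<and> L u $ 2 $ 2 = - \<alpha> u \<and> L u $ 1 $ 2 = 0"
    and \<Phi>: "\<And>u w. vertex_form Ms p u w = \<Phi> u w"
    using assms(1) by (auto simp: lower_vertex_def lower_log_def)
  obtain x where J: "has_log_deriv J p (diag_log \<zeta>)" and x: "x \<noteq> 0" "J p = Dmat x"
    using assms(2) by (auto simp: diagonal_jump_def)
  define L' where "L' u = matrix_inv (J p) ** L u ** J p + diag_log \<zeta> u" for u
  have L': "has_log_deriv (mat_prod (Ms @ [J])) p L'"
    unfolding L'_def using L(1) J by (rule has_log_deriv_mat_prod_snoc)
  have ent: "L' u $ 1 $ 1 = \<alpha> u - \<zeta> u \<and> L' u $ 2 $ 2 = - (\<alpha> u - \<zeta> u) \<and> L' u $ 1 $ 2 = 0" for u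
    using x L(2)[of u]
    by (simp add: L'_def matrix_inv_Dmat)
      (simp add: matrix_mult_2_nth Dmat_def diag_log_def field_simps)
  have "vertex_form (Ms @ [J]) p u w = \<Phi> u w - 2 * wedge_at \<alpha> \<zeta> u w" for u w
    unfolding vertex_form_snoc \<Phi> trace_wedge_diag[OF has_log_deriv_imp_log_diff[OF J]]
      has_log_deriv_imp_log_diff[OF L']
    by (simp add: ent) (simp add: algebra_simps)
  then show ?thesis
    using L' ent by (auto simp: lower_vertex_def lower_log_def)
qed

lemma upper_vertex_D:
  assumes "upper_vertex Ms p \<alpha> \<Phi>" "diagonal_jump J p \<zeta>"
  shows "upper_vertex (Ms @ [J]) p (\<lambda>u. \<alpha> u - \<zeta> u) (\<lambda>u w. \<Phi> u w - 2 * wedge_at \<alpha> \<zeta> u w)"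
proof -
  obtain L where L: "has_log_deriv (mat_prod Ms) p L"
    "\<And>u. L u $ 1 $ 1 = \<alpha> u \<and> L u $ 2 $ 2 = - \<alpha> u \<and> L u $ 2 $ 1 = 0"
    and \<Phi>: "\<And>u w. vertex_form Ms p u w = \<Phi> u w"
    using assms(1) by (auto simp: upper_vertex_def upper_log_def)
  obtain x where J: "has_log_deriv J p (diag_log \<zeta>)" and x: "x \<noteq> 0" "J p = Dmat x"
    using assms(2) by (auto simp: diagonal_jump_def)
  define L' where "L' u = matrix_inv (J p) ** L u ** J p + diag_log \<zeta> u" for u
  have L': "has_log_deriv (mat_prod (Ms @ [J])) p L'"
    unfolding L'_def using L(1) J by (rule has_log_deriv_mat_prod_snoc)
  have ent: "L' u $ 1 $ 1 = \<alpha> u - \<zeta> u \<and> L' u $ 2 $ 2 = - (\<alpha> u - \<zeta> u) \<and> L' u $ 2 $ 1 = 0" for u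
    using x L(2)[of u]
    by (simp add: L'_def matrix_inv_Dmat)
      (simp add: matrix_mult_2_nth Dmat_def diag_log_def field_simps)
  have "vertex_form (Ms @ [J]) p u w = \<Phi> u w - 2 * wedge_at \<alpha> \<zeta> u w" for u w
    unfolding vertex_form_snoc \<Phi> trace_wedge_diag[OF has_log_deriv_imp_log_diff[OF J]]
      has_log_deriv_imp_log_diff[OF L']
    by (simp add: ent) (simp add: algebra_simps)
  then show ?thesis
    using L' ent by (auto simp: upper_vertex_def upper_log_def)
qed

text \<open>\<open>Amat ** Vmat x\<close> is lower triangular with the diagonal of
  \<open>Dmat x\<close>, so the pair acts like one diagonal jump; the constant letter
  \<open>Amat\<close> contributes nothing by itself.\<close>

lemma lower_vertex_AV:
  assumes "lower_vertex Ms p \<alpha> \<Phi>" "antidiagonal_jump J p \<zeta>"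
  shows "lower_vertex (Ms @ [\<lambda>_. Amat, J]) p (\<lambda>u. \<alpha> u - \<zeta> u) (\<lambda>u w. \<Phi> u w - 2 * wedge_at \<alpha> \<zeta> u w)"
proof -
  obtain L where L: "has_log_deriv (mat_prod Ms) p L"
    "\<And>u. L u $ 1 $ 1 = \<alpha> u \<and> L u $ 2 $ 2 = - \<alpha> u \<and> L u $ 1 $ 2 = 0"
    and \<Phi>: "\<And>u w. vertex_form Ms p u w = \<Phi> u w"
    using assms(1) by (auto simp: lower_vertex_def lower_log_def)
  obtain x where J: "has_log_deriv J p (diag_log \<zeta>)" and x: "x \<noteq> 0" "J p = Vmat x"
    using assms(2) by (auto simp: antidiagonal_jump_def)
  note A = has_log_deriv_const[OF det_Amat, of p]
  note LA = has_log_deriv_mat_prod_snoc[OF L(1) A]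
  define L' where
    "L' u = matrix_inv (J p) ** (matrix_inv Amat ** L u ** Amat + 0) ** J p + diag_log \<zeta> u" for u
  have "has_log_deriv (mat_prod ((Ms @ [\<lambda>_. Amat]) @ [J])) p L'"
    unfolding L'_def using LA J by (rule has_log_deriv_mat_prod_snoc)
  then have L': "has_log_deriv (mat_prod (Ms @ [\<lambda>_. Amat, J])) p L'"
    by simp
  have ent: "L' u $ 1 $ 1 = \<alpha> u - \<zeta> u \<and> L' u $ 2 $ 2 = - (\<alpha> u - \<zeta> u) \<and> L' u $ 1 $ 2 = 0" for u
    using x L(2)[of u]
    by (simp add: L'_def matrix_inv_Vmat matrix_inv_Amat)
      (simp add: matrix_mult_2_nth Vmat_def Amat_def diag_log_def field_simps)
  have "vertex_form ((Ms @ [\<lambda>_. Amat]) @ [J]) p u w = \<Phi> u w - 2 * wedge_at \<alpha> \<zeta> u w" for u w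
    unfolding vertex_form_snoc \<Phi> trace_wedge_diag[OF has_log_deriv_imp_log_diff[OF J]]
      trace_wedge_zero[OF has_log_deriv_imp_log_diff[OF A]]
    unfolding append_assoc append.simps has_log_deriv_imp_log_diff[OF L']
    by (simp add: ent) (simp add: algebra_simps)
  then show ?thesis
    using L' ent by (auto simp: lower_vertex_def lower_log_def)
qed

text \<open>\<open>Vmat x ** Amat\<close> is upper triangular with the diagonal of
  \<open>Dmat (inverse x)\<close>, which explains the plus sign in front of \<zeta>.\<close>

lemma upper_vertex_VA:
  assumes "upper_vertex Ms p \<alpha> \<Phi>" "antidiagonal_jump J p \<zeta>"
  shows "upper_vertex (Ms @ [J, \<lambda>_. Amat]) p (\<lambda>u. \<alpha> u + \<zeta> u) (\<lambda>u w. \<Phi> u w + 2 * wedge_at \<alpha> \<zeta> u w)"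
proof -
  obtain L where L: "has_log_deriv (mat_prod Ms) p L"
    "\<And>u. L u $ 1 $ 1 = \<alpha> u \<and> L u $ 2 $ 2 = - \<alpha> u \<and> L u $ 2 $ 1 = 0"
    and \<Phi>: "\<And>u w. vertex_form Ms p u w = \<Phi> u w"
    using assms(1) by (auto simp: upper_vertex_def upper_log_def)
  obtain x where J: "has_log_deriv J p (diag_log \<zeta>)" and x: "x \<noteq> 0" "J p = Vmat x"
    using assms(2) by (auto simp: antidiagonal_jump_def)
  note A = has_log_deriv_const[OF det_Amat, of p]
  define L' where "L' u = matrix_inv (J p) ** L u ** J p + diag_log \<zeta> u" for u
  have L': "has_log_deriv (mat_prod (Ms @ [J])) p L'"
    unfolding L'_def using L(1) J by (rule has_log_deriv_mat_prod_snoc)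
  define L'' where "L'' u = matrix_inv Amat ** L' u ** Amat + 0" for u
  have "has_log_deriv (mat_prod ((Ms @ [J]) @ [\<lambda>_. Amat])) p L''"
    unfolding L''_def using L' A by (rule has_log_deriv_mat_prod_snoc)
  then have L'': "has_log_deriv (mat_prod (Ms @ [J, \<lambda>_. Amat])) p L''"
    by simp
  \<comment> \<open>Conjugation by V exchanges the diagonal entries and makes the matrix lower
    triangular; the form must be read off at this halfway point. The following \<open>Amat\<close>
    undoes the exchange.\<close>
  have ent: "L' u $ 1 $ 1 = - (\<alpha> u + \<zeta> u) \<and> L' u $ 2 $ 2 = \<alpha> u + \<zeta> u \<and> L' u $ 1 $ 2 = 0" for u
    using x L(2)[of u]
    by (simp add: L'_def matrix_inv_Vmat)
      (simp add: matrix_mult_2_nth Vmat_def diag_log_def field_simps)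
  then have ent': "L'' u $ 1 $ 1 = \<alpha> u + \<zeta> u \<and> L'' u $ 2 $ 2 = - (\<alpha> u + \<zeta> u) \<and> L'' u $ 2 $ 1 = 0" for u
    by (simp add: L''_def matrix_inv_Amat) (simp add: matrix_mult_2_nth Amat_def algebra_simps)
  have "vertex_form ((Ms @ [J]) @ [\<lambda>_. Amat]) p u w = \<Phi> u w + 2 * wedge_at \<alpha> \<zeta> u w" for u w
    unfolding vertex_form_snoc \<Phi> trace_wedge_diag[OF has_log_deriv_imp_log_diff[OF J]]
      trace_wedge_zero[OF has_log_deriv_imp_log_diff[OF A]]
      has_log_deriv_imp_log_diff[OF L']
    by (simp add: ent) (simp add: algebra_simps)
  then show ?thesis
    using L'' ent' by (auto simp: upper_vertex_def upper_log_def)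
qed

section \<open>The two-form of \<open>\<Sigma>\<^sub>0\<close>\<close>

text \<open>The defining sum stops before the last edge of each star, so the rays at the polygon
  vertices drop out, and at the centres all jumps are constant.\<close>

lemma standard_two_form_sigma0:
  fixes e :: "nat \<Rightarrow> 'n::finite"
  assumes "K \<ge> 1"
  shows "standard_two_form (sigma0 K e) p u w =
    (\<Sum>i=1..2*K+2. vertex_form (map snd (inner_list K e i)) p u w)"
proof -
  let ?G = "sigma0 K e"
  have vertex: "(\<Sum>k=1..length (star ?G v) - 1.
        trace_wedge (log_diff (mat_prod (map (jump ?G) (take k (star ?G v)))))
                    (log_diff (jump ?G (star ?G v ! (k - 1)))) p u w)
      = vertex_form (butlast (map snd (out_list K e v))) p u w" (is "?S = _")
    if v: "v \<in> verts ?G" for v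
  proof -
    let ?L = "map snd (out_list K e v)"
    have L: "map (jump ?G) (star ?G v) = ?L"
      by (rule jump_star_sigma0[OF assms v])
    then have len: "length (star ?G v) = length ?L"
      using length_map by metis
    have tk: "map (jump ?G) (take k (star ?G v)) = take k ?L" for k
      unfolding L [symmetric] by (rule take_map [symmetric])
    have nt: "jump ?G (star ?G v ! k) = ?L ! k" if "k < length ?L" for k
      using that nth_map[of k "star ?G v" "jump ?G"] unfolding L len by simp
    have "?S = (\<Sum>k=1..length ?L - 1. trace_wedge (log_diff (mat_prod (take k ?L)))
                    (log_diff (?L ! (k - 1))) p u w)"
      unfolding tk len
    proof (intro sum.cong refl)
      fix k assume "k \<in> {1..length ?L - 1}"
      then have "k - 1 < length ?L" by auto
      then show "trace_wedge (log_diff (mat_prod (take k ?L)))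
            (log_diff (jump ?G (star ?G v ! (k - 1)))) p u w =
          trace_wedge (log_diff (mat_prod (take k ?L))) (log_diff (?L ! (k - 1))) p u w"
        by (simp only: nt)
    qed
    also have "\<dots> = vertex_form (butlast ?L) p u w"
      by (auto simp: vertex_form_def nth_butlast take_butlast intro!: sum.cong)
    finally show ?thesis .
  qed
  have ctr: "vertex_form (butlast (map snd (out_list K e (Ctr j)))) p u w = 0" for j
  proof -
    have "log_diff (\<lambda>_. matrix_inv Amat) p u = 0" for u
      by (intro has_log_deriv_imp_log_diff has_log_deriv_const det_matrix_inv det_Amat)
    then show ?thesis
      by (simp add: vertex_form_def trace_wedge_zero numeral_2_eq_2)
  qed
  have "standard_two_form ?G p u w =
      (\<Sum>v\<in>verts ?G. vertex_form (butlast (map snd (out_list K e v))) p u w)"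
    unfolding standard_two_form_def by (intro sum.cong refl vertex)
  also have "\<dots> = (\<Sum>v\<in>Pt ` {1..2*K+2}. vertex_form (butlast (map snd (out_list K e v))) p u w) +
      (\<Sum>v\<in>Ctr ` {1..2*K}. vertex_form (butlast (map snd (out_list K e v))) p u w)"
    unfolding sigma0_def by (simp only: jump_graph.simps) (rule sum.union_disjoint, auto)
  also have "\<dots> = (\<Sum>i=1..2*K+2. vertex_form (map snd (inner_list K e i)) p u w)"
    by (simp add: sum.reindex inj_on_def ctr del: out_list.simps(2))
  finally show ?thesis .
qed

lemma lower_vertex_form: "lower_vertex Ms p \<alpha> \<Phi> \<Longrightarrow> vertex_form Ms p u w = \<Phi> u w"
  by (simp add: lower_vertex_def)

lemma upper_vertex_form: "upper_vertex Ms p \<alpha> \<Phi> \<Longrightarrow> vertex_form Ms p u w = \<Phi> u w"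
  by (simp add: upper_vertex_def)

section \<open>The forms d log y and d log x\<close>

definition dlog_coord :: "(nat \<Rightarrow> 'n) \<Rightarrow> complex^'n \<Rightarrow> nat \<Rightarrow> complex^'n::finite \<Rightarrow> complex" where
  "dlog_coord e p i u = u $ e i / p $ e i"

definition dlog_x :: "(nat \<Rightarrow> 'n) \<Rightarrow> complex^'n \<Rightarrow> nat \<Rightarrow> complex^'n::finite \<Rightarrow> complex" where
  "dlog_x e p l u = (\<Sum>j=1..l. (-1) ^ (j + 1) * dlog_coord e p j u)"

lemma dlog_x_Suc: "dlog_x e p (Suc l) u = dlog_x e p l u + (-1) ^ l * dlog_coord e p (Suc l) u"
  by (simp add: dlog_x_def)

lemma has_dlog_dlog_coord: "p \<in> torus \<Longrightarrow> has_dlog (\<lambda>y. y $ e i) p (dlog_coord e p i)"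
  unfolding dlog_coord_def [abs_def] by (rule has_dlog_coord) (simp add: torus_def)

text \<open>Each factor has exponent 1 or -1, so it is a coordinate or its inverse. The second claim
  carries \<open>2 * K\<close> on the right because x with index \<open>2 * K + 1\<close> is set
  equal to its predecessor.\<close>

lemma has_dlog_xcoord:
  assumes "p \<in> torus"
  shows "l \<le> 2 * K \<Longrightarrow> has_dlog (xcoord K e l) p (dlog_x e p l)"
    and "has_dlog (xcoord K e (2 * K + 1)) p (dlog_x e p (2 * K))"
proof -
  have factor: "has_dlog (\<lambda>y. (y $ e j) powi ((-1) ^ (j + 1))) p
      (\<lambda>u. (-1) ^ (j + 1) * dlog_coord e p j u)" for j
    using has_dlog_dlog_coord[OF assms, of e j] has_dlog_inverse[OF has_dlog_dlog_coord[OF assms, of e j]]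
    by (cases "even j") auto
  show "l \<le> 2 * K \<Longrightarrow> has_dlog (xcoord K e l) p (dlog_x e p l)"
    using has_dlog_prod[OF finite_atLeastAtMost[of "1::nat" l] factor]
    unfolding xcoord_def [abs_def] dlog_x_def [abs_def] by simp
  show "has_dlog (xcoord K e (2 * K + 1)) p (dlog_x e p (2 * K))"
    using has_dlog_prod[OF finite_atLeastAtMost[of "1::nat" "2 * K"] factor]
    unfolding xcoord_def [abs_def] dlog_x_def [abs_def] by simp
qed

section \<open>Contributions of the single polygon vertices\<close>

text \<open>Only multiples of d log y_1 occur, so every wedge is zero.\<close>

lemma vertex_form_first:
  fixes e :: "nat \<Rightarrow> 'n::finite"
  assumes "p \<in> torus"
  shows "vertex_form (map snd (inner_list K e 1)) p u w = 0"
proof -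
  note y = has_dlog_dlog_coord[OF assms, of e 1]
  note H = upper_vertex_form[OF upper_vertex_D[OF upper_vertex_VA[OF upper_vertex_Nil
        antidiagonal_jump_Vmat[OF has_dlog_inverse[OF y]]] diagonal_jump_inv_Dmat[OF y]]]
  show ?thesis
    by (simp add: inner_list_def H[simplified])
qed

text \<open>The list is D followed by two blocks A V, hence lower triangular throughout. Before the
  last block \<alpha> equals - \<open>dlog_x e p (i - 1)\<close>, a multiple of the last \<zeta>, so
  only the diagonal edge contributes.\<close>

lemma vertex_form_even:
  fixes e :: "nat \<Rightarrow> 'n::finite"
  assumes "p \<in> torus" "even i" "2 \<le> i" "i \<le> 2 * K"
  shows "vertex_form (map snd (inner_list K e i)) p u w =
    2 * wedge_at (dlog_x e p (i - 1)) (dlog_coord e p i) u w"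
proof -
  note y = has_dlog_dlog_coord[OF assms(1), of e i]
  have x: "has_dlog (xcoord K e i) p (dlog_x e p i)"
    "has_dlog (xcoord K e (i - 1)) p (dlog_x e p (i - 1))"
    using assms by (auto intro!: has_dlog_xcoord)
  note H = lower_vertex_form[OF lower_vertex_AV[OF lower_vertex_AV[OF lower_vertex_D[OF lower_vertex_Nil
        diagonal_jump_Dmat[OF x(1)]] antidiagonal_jump_inv_Vmat[OF y]]
        antidiagonal_jump_inv_Vmat[OF has_dlog_inverse[OF x(2)]]]]
  have x_eq: "dlog_x e p i u = dlog_x e p (i - 1) u - dlog_coord e p i u" for u
    using dlog_x_Suc[of e p "i - 1"] assms by (cases i) auto
  show ?thesis
    using assms
    by (simp add: inner_list_def H[simplified]) (simp add: x_eq algebra_simps)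
qed

text \<open>Two blocks V A followed by an inverse D keep the products upper triangular. Again only
  the edge carrying y_i contributes, now with the opposite sign.\<close>

lemma vertex_form_odd:
  fixes e :: "nat \<Rightarrow> 'n::finite"
  assumes "p \<in> torus" "odd i" "3 \<le> i" "i < 2 * K"
  shows "vertex_form (map snd (inner_list K e i)) p u w =
    - 2 * wedge_at (dlog_x e p (i - 1)) (dlog_coord e p i) u w"
proof -
  note y = has_dlog_dlog_coord[OF assms(1), of e i]
  have x: "has_dlog (xcoord K e i) p (dlog_x e p i)"
    "has_dlog (xcoord K e (i - 1)) p (dlog_x e p (i - 1))"
    using assms by (auto intro!: has_dlog_xcoord)
  note H = upper_vertex_form[OF upper_vertex_D[OF upper_vertex_VA[OF upper_vertex_VA[OF upper_vertex_Nil
        antidiagonal_jump_Vmat[OF has_dlog_inverse[OF x(1)]]] antidiagonal_jump_Vmat[OF y]]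
        diagonal_jump_inv_Dmat[OF x(2)]]]
  have x_eq: "dlog_x e p i u = dlog_x e p (i - 1) u + dlog_coord e p i u" for u
    using dlog_x_Suc[of e p "i - 1"] assms by (cases i) auto
  show ?thesis
    using assms
    by (simp add: inner_list_def H[simplified]) (simp add: x_eq algebra_simps)
qed

text \<open>Both x-coordinates at this vertex have the same d log, so all wedges are of a form with
  itself.\<close>

lemma vertex_form_penultimate:
  fixes e :: "nat \<Rightarrow> 'n::finite"
  assumes "p \<in> torus" "K \<ge> 1"
  shows "vertex_form (map snd (inner_list K e (2 * K + 1))) p u w = 0"
proof -
  have x: "has_dlog (xcoord K e (2 * K)) p (dlog_x e p (2 * K))"
    "has_dlog (xcoord K e (2 * K + 1)) p (dlog_x e p (2 * K))"
    using has_dlog_xcoord[OF assms(1)] by auto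
  note H = upper_vertex_form[OF upper_vertex_D[OF upper_vertex_VA[OF upper_vertex_Nil
        antidiagonal_jump_Vmat[OF has_dlog_inverse[OF x(2)]]] diagonal_jump_inv_Dmat[OF x(1)]]]
  show ?thesis
    using assms(2)
    by (simp add: inner_list_def H[simplified])
qed

text \<open>Regroups blocks V A as blocks A V, the shape that \<open>lower_vertex_AV\<close> can
  absorb after the leading diagonal letter.\<close>

lemma concat_map_shift: "a # concat (map (\<lambda>j. [f j, a]) xs) = concat (map (\<lambda>j. [a, f j]) xs) @ [a]"
  by (induction xs) auto

text \<open>After regrouping, the block with V_j meets \<alpha> = minus the sum of the earlier d log
  y_i, which gives the double sum; the closing block with \<open>W\<close> meets the full sum and
  gives the correction.\<close>

lemma vertex_form_last:
  fixes e :: "nat \<Rightarrow> 'n::finite"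
  assumes "p \<in> torus" "K \<ge> 1"
  shows "vertex_form (map snd (inner_list K e (2 * K + 2))) p u w =
    2 * (\<Sum>j=2..2 * K. \<Sum>i=1..<j. wedge_at (dlog_coord e p i) (dlog_coord e p j) u w)
    - 2 * (\<Sum>i=1..2 * K. wedge_at (dlog_coord e p i) (dlog_x e p (2 * K)) u w)"
proof -
  note y = has_dlog_dlog_coord[OF assms(1), of e]
  note x = has_dlog_xcoord(2)[OF assms(1), of K e]
  define V where "V j y = (if even j then Vmat (y $ e j) else matrix_inv (Vmat (y $ e j)))"
    for j and y :: "complex^'n"
  define A where "A = (\<lambda>y :: complex^'n. Amat)"
  define D where "D y = Dmat (y $ e 1)" for y :: "complex^'n"
  define W where "W y = matrix_inv (Vmat (inverse (xcoord K e (2 * K + 1) y)))" for y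
  \<comment> \<open>V and its inverse have the same logarithmic derivative, so one \<zeta> serves
    both parities.\<close>
  have V: "antidiagonal_jump (V j) p (dlog_coord e p j)" for j
    using antidiagonal_jump_Vmat[OF y[of j]] antidiagonal_jump_inv_Vmat[OF y[of j]]
    by (cases "even j") (auto simp: V_def [abs_def])
  have D: "diagonal_jump D p (dlog_coord e p 1)"
    unfolding D_def [abs_def] by (rule diagonal_jump_Dmat[OF y])
  have W: "antidiagonal_jump W p (\<lambda>u. - dlog_x e p (2 * K) u)"
    unfolding W_def [abs_def] by (intro antidiagonal_jump_inv_Vmat has_dlog_inverse x)
  have "map snd (inner_list K e (2 * K + 2)) =
      [D] @ (A # concat (map (\<lambda>j. [V j, A]) [2..<2 * K + 1])) @ [W]"
    unfolding inner_list_def using assms(2)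
    by (simp add: map_concat o_def V_def [abs_def] A_def D_def [abs_def] W_def [abs_def])
  also have "\<dots> = ([D] @ concat (map (\<lambda>j. [A, V j]) [2..<2 * K + 1])) @ [A, W]"
    by (simp only: concat_map_shift append_assoc append.simps)
  finally have list: "map snd (inner_list K e (2 * K + 2)) = \<dots>" .
  \<comment> \<open>Here \<open>m\<close> is the first index not yet collected; the base case
    \<open>m = 2\<close> consists of the letter \<open>D\<close> alone, with \<alpha> = - d log
    y_1.\<close>
  have "lower_vertex ([D] @ concat (map (\<lambda>j. [A, V j]) [2..<m])) p
      (\<lambda>u. - (\<Sum>i=1..<m. dlog_coord e p i u))
      (\<lambda>u w. 2 * (\<Sum>j=2..<m. \<Sum>i=1..<j. wedge_at (dlog_coord e p i) (dlog_coord e p j) u w))"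
    if "m \<ge> 2" for m
    using that
  proof (induction m rule: nat_induct_at_least)
    case base
    then show ?case
      using lower_vertex_D[OF lower_vertex_Nil D] by (simp add: numeral_2_eq_2)
  next
    case (Suc m)
    have \<alpha>: "- (\<Sum>i=1..<Suc m. dlog_coord e p i u) =
        - (\<Sum>i=1..<m. dlog_coord e p i u) - dlog_coord e p m u" for u
      using Suc.hyps by simp
    have \<Phi>: "2 * (\<Sum>j=2..<Suc m. \<Sum>i=1..<j. wedge_at (dlog_coord e p i) (dlog_coord e p j) u w) =
        2 * (\<Sum>j=2..<m. \<Sum>i=1..<j. wedge_at (dlog_coord e p i) (dlog_coord e p j) u w) -
        2 * wedge_at (\<lambda>u. - (\<Sum>i=1..<m. dlog_coord e p i u)) (dlog_coord e p m) u w" for u w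
      using Suc.hyps by (simp add: sum_subtractf algebra_simps flip: sum_distrib_right)
    show ?case
      using lower_vertex_AV[OF Suc.IH V[of m]] Suc.hyps unfolding \<alpha> \<Phi> by (simp add: A_def)
  qed
  note H = lower_vertex_form[OF lower_vertex_AV[OF this[of "2 * K + 1"] W, folded A_def]]
  have h: "(\<Sum>i=1..2 * K. wedge_at (dlog_coord e p i) (dlog_x e p (2 * K)) u w) =
      wedge_at (\<lambda>u. \<Sum>i=1..2 * K. dlog_coord e p i u) (dlog_x e p (2 * K)) u w"
    by (simp add: sum_subtractf flip: sum_distrib_right)
  show ?thesis
    using assms(2) unfolding list h
    by (subst H) (simp_all add: atLeastLessThanSuc_atLeastAtMost algebra_simps)
qed

section \<open>Summation over the vertices\<close>

text \<open>\<open>a i\<close> and \<open>b i\<close> stand for d log y_i on two tangent vectors,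
  and \<open>X\<close> for d log x. Passing from \<open>K\<close> to \<open>Suc K\<close> changes
  either side by an expression in which earlier coordinates enter only through plain and alternating
  sums, so the increments can be compared as polynomials.\<close>

lemma sum_vertex_forms:
  fixes a b :: "nat \<Rightarrow> complex"
  defines "X \<equiv> \<lambda>c l. \<Sum>j=1..l. (-1) ^ (j + 1) * c j"
  shows "(\<Sum>i=2..2*K. 2 * (-1) ^ i * (X a (i - 1) * b i - X b (i - 1) * a i))
    + (2 * (\<Sum>j=2..2*K. \<Sum>i=1..<j. a i * b j - b i * a j)
     - 2 * (\<Sum>i=1..2*K. a i * X b (2*K) - b i * X a (2*K)))
   = 8 * (\<Sum>j=1..K. \<Sum>l=j..K. a (2*j-1) * b (2*l) - b (2*j-1) * a (2*l))" (is "?L K = ?R K")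
proof (induction K)
  case 0
  then show ?case by simp
next
  case (Suc K)
  define S where "S c = (\<Sum>i=1..2*K. c i)" for c :: "nat \<Rightarrow> complex"
  have X: "X c (Suc n) = X c n + (-1) ^ n * c (Suc n)" for c n
    by (simp add: X_def)
  \<comment> \<open>Odd indices carry a plus sign in \<open>X\<close>; adding the plain sum doubles
    these terms and cancels the even ones.\<close>
  have odd_sum: "2 * (\<Sum>j=1..K. c (2*j-1)) = S c + X c (2*K)" for c
    unfolding S_def X_def by (induction K) (auto simp: algebra_simps)
  \<comment> \<open>For \<open>j\<close> up to \<open>K\<close> the inner sum gains the term at
    \<open>Suc K\<close>; the new outer index \<open>j = Suc K\<close> has only that term.\<close>
  have split: "(\<Sum>l=j..Suc K. f l) = (\<Sum>l=j..K. f l) + f (Suc K)"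
    if "j \<le> K" for j and f :: "nat \<Rightarrow> complex"
    using that by simp
  have "8 * (\<Sum>j=1..Suc K. c (2*j-1)) = 4 * (S c + X c (2*K) + 2 * c (2*K+1))" for c
    unfolding odd_sum [symmetric] by simp
  moreover have "?R (Suc K) = ?R K +
      ((8 * (\<Sum>j=1..Suc K. a (2*j-1))) * b (2*K+2) - (8 * (\<Sum>j=1..Suc K. b (2*j-1))) * a (2*K+2))"
    by (simp add: split sum.distrib sum_subtractf sum_distrib_right sum_distrib_left algebra_simps)
  ultimately have R: "?R (Suc K) = ?R K +
      (4 * (S a + X a (2*K) + 2 * a (2*K+1)) * b (2*K+2) -
       4 * (S b + X b (2*K) + 2 * b (2*K+1)) * a (2*K+2))"
    by simp
  \<comment> \<open>The terms at index 1 vanish, being built from empty sums. Starting at 1 aligns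
    the ranges, also when \<open>K\<close> is 0.\<close>
  have from_1: "(\<Sum>i=2..n. f i) = (\<Sum>i=1..n. f i)" if "f 1 = 0" for f :: "nat \<Rightarrow> complex" and n
    using that by (cases n) (simp_all add: sum.atLeast_Suc_atMost numeral_2_eq_2)
  define f where "f i = 2 * (-1) ^ i * (X a (i - 1) * b i - X b (i - 1) * a i)" for i
  define g where "g j = (\<Sum>i=1..<j. a i * b j - b i * a j)" for j
  have f: "(\<Sum>i=2..n. f i) = (\<Sum>i=1..n. f i)" for n
    by (rule from_1) (simp add: f_def X_def)
  have g: "(\<Sum>i=2..n. g i) = (\<Sum>i=1..n. g i)" for n
    by (rule from_1) (simp add: g_def)
  have g_eq: "g j = (\<Sum>i=1..<j. a i) * b j - (\<Sum>i=1..<j. b i) * a j" for j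
    by (simp add: g_def sum_subtractf sum_distrib_right)
  have h_eq: "(\<Sum>i=1..n. a i * x - b i * y) = (\<Sum>i=1..n. a i) * x - (\<Sum>i=1..n. b i) * y" for n x y
    by (simp add: sum_subtractf sum_distrib_right)
  have two: "2 * Suc K = 2*K+2"
    by simp
  have sum_two: "(\<Sum>i=1..2*K+2. c i) = S c + c (2*K+1) + c (2*K+2)" for c
    by (simp add: S_def)
  have X1: "X c (2*K+1) = X c (2*K) + c (2*K+1)" for c
    by (simp add: X)
  have X2: "X c (2*K+2) = X c (2*K) + c (2*K+1) - c (2*K+2)" for c
    by (simp add: X)
  have f1: "f (2*K+1) = - 2 * (X a (2*K) * b (2*K+1) - X b (2*K) * a (2*K+1))"
    by (simp add: f_def)
  have f2: "f (2*K+2) = 2 * (X a (2*K+1) * b (2*K+2) - X b (2*K+1) * a (2*K+2))"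
    by (simp add: f_def)
  have g1: "g (2*K+1) = S a * b (2*K+1) - S b * a (2*K+1)"
    by (simp add: g_eq S_def atLeastLessThanSuc_atLeastAtMost)
  have g2: "g (2*K+2) = (S a + a (2*K+1)) * b (2*K+2) - (S b + b (2*K+1)) * a (2*K+2)"
    by (simp add: g_eq S_def atLeastLessThanSuc_atLeastAtMost)
  have "(\<Sum>i=1..2*Suc K. f i) + (2 * (\<Sum>i=1..2*Suc K. g i)
       - 2 * (\<Sum>i=1..2*Suc K. a i * X b (2*Suc K) - b i * X a (2*Suc K))) =
     (\<Sum>i=1..2*K. f i) + (2 * (\<Sum>i=1..2*K. g i)
       - 2 * (\<Sum>i=1..2*K. a i * X b (2*K) - b i * X a (2*K))) +
      (4 * (S a + X a (2*K) + 2 * a (2*K+1)) * b (2*K+2) -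
       4 * (S b + X b (2*K) + 2 * b (2*K+1)) * a (2*K+2))"
    unfolding two h_eq sum_two f1 f2 g1 g2 X1 X2 S_def [symmetric]
    by (simp add: algebra_simps)
  then show ?case
    unfolding R Suc.IH [symmetric] f_def [symmetric] g_def [symmetric] f g .
qed

lemma standard_two_form_sigma0_eq:
  fixes e :: "nat \<Rightarrow> 'n::finite"
  assumes "K \<ge> 1" "p \<in> torus"
  shows "standard_two_form (sigma0 K e) p u w =
    8 * (\<Sum>j=1..K. \<Sum>l=j..K. wedge_at (dlog_coord e p (2 * j - 1)) (dlog_coord e p (2 * l)) u w)"
proof -
  let ?F = "\<lambda>i. vertex_form (map snd (inner_list K e i)) p u w"
  \<comment> \<open>The sign (-1)^i merges the even and odd vertices into the single formula
    expected by \<open>sum_vertex_forms\<close>.\<close>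
  have middle: "?F i = 2 * (-1) ^ i * wedge_at (dlog_x e p (i - 1)) (dlog_coord e p i) u w"
    if "i \<in> {2..2 * K}" for i
  proof (cases "even i")
    case True
    then show ?thesis
      using that vertex_form_even[OF assms(2)] by auto
  next
    case False
    then have "3 \<le> i" "i < 2 * K"
      using that by (auto, presburger+)
    then show ?thesis
      using False vertex_form_odd[OF assms(2)] by auto
  qed
  have "(\<Sum>i=1..2*K+2. ?F i) = ?F 1 + (\<Sum>i=2..2*K. ?F i) + ?F (2*K+1) + ?F (2*K+2)"
    using assms(1) by (simp add: sum.atLeast_Suc_atMost numeral_2_eq_2)
  also have "\<dots> = (\<Sum>i=2..2*K. 2 * (-1) ^ i * wedge_at (dlog_x e p (i - 1)) (dlog_coord e p i) u w)
      + ?F (2*K+2)"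
    unfolding vertex_form_first[OF assms(2)] vertex_form_penultimate[OF assms(2,1)]
    by (simp add: middle)
  also have "\<dots> = 8 * (\<Sum>j=1..K. \<Sum>l=j..K. wedge_at (dlog_coord e p (2 * j - 1)) (dlog_coord e p (2 * l)) u w)"
    unfolding vertex_form_last[OF assms(2,1)] dlog_x_def
    by (rule sum_vertex_forms)
  finally show ?thesis
    unfolding standard_two_form_sigma0[OF assms(1)] .
qed

section \<open>Holomorphy, closedness and nondegeneracy on the torus\<close>

lemma open_torus: "open (torus :: (complex^'n::finite) set)"
proof -
  have eq: "torus = (\<Inter>i. {y :: complex^'n. y $ i \<noteq> 0})"
    by (auto simp: torus_def)
  show ?thesis
    unfolding eq by (intro open_INT open_Collect_neq continuous_intros ballI) auto
qed

text \<open>Expressing the derivative of 1/y again through values of d log keeps all later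
  computations polynomial in these values.\<close>

lemma dlog_coord_has_derivative:
  assumes "p \<in> torus"
  shows "((\<lambda>q. dlog_coord e q j b) has_derivative
    (\<lambda>a. - dlog_coord e p j a * dlog_coord e p j b)) (at p)"
proof -
  have nz: "p $ e j \<noteq> 0"
    using assms by (simp add: torus_def)
  have "((\<lambda>q. inverse (q $ e j)) has_derivative
      (\<lambda>a. - (inverse (p $ e j) * a $ e j * inverse (p $ e j)))) (at p)"
    using nz by (intro Deriv.has_derivative_inverse bounded_linear_imp_has_derivative bounded_linear_vec_nth) auto
  from has_derivative_mult_right[OF this, of "b $ e j"] show ?thesis
    by (simp add: dlog_coord_def divide_inverse mult_ac)
qed

lemma wedge_dlog_coord_has_derivative:
  assumes "p \<in> torus"
  shows "((\<lambda>q. wedge_at (dlog_coord e q j) (dlog_coord e q l) b c) has_derivative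
    (\<lambda>a. - (dlog_coord e p j a + dlog_coord e p l a) *
       wedge_at (dlog_coord e p j) (dlog_coord e p l) b c)) (at p)"
  by (rule has_derivative_eq_rhs, (rule has_derivative_diff has_derivative_mult
      dlog_coord_has_derivative[OF assms])+) (simp add: algebra_simps)

text \<open>The direction \<open>a\<close> of differentiation comes last, so that partial
  application yields the Frechet derivative.\<close>

definition two_form_derivative where
  "two_form_derivative K e p b c a = 8 * (\<Sum>j=1..K. \<Sum>l=j..K.
     - (dlog_coord e p (2 * j - 1) a + dlog_coord e p (2 * l) a) *
       wedge_at (dlog_coord e p (2 * j - 1)) (dlog_coord e p (2 * l)) b c)"

text \<open>The explicit formula is available on the torus, which is open, so it may be
  differentiated in place of the form.\<close>

lemma standard_two_form_sigma0_has_derivative: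
  fixes e :: "nat \<Rightarrow> 'n::finite"
  assumes "K \<ge> 1" "p \<in> torus"
  shows "((\<lambda>q. standard_two_form (sigma0 K e) q b c) has_derivative
    two_form_derivative K e p b c) (at p)"
proof (rule has_derivative_transform_within_open[OF _ open_torus assms(2)])
  show "((\<lambda>q. 8 * (\<Sum>j=1..K. \<Sum>l=j..K.
        wedge_at (dlog_coord e q (2 * j - 1)) (dlog_coord e q (2 * l)) b c)) has_derivative
      two_form_derivative K e p b c) (at p)"
    unfolding two_form_derivative_def [abs_def]
    by (intro has_derivative_mult_right has_derivative_sum wedge_dlog_coord_has_derivative assms(2))
qed (rule standard_two_form_sigma0_eq[OF assms(1), symmetric])

text \<open>Holomorphy asks for complex linearity, whereas \<open>has_derivative\<close> yields only
  real linearity; this criterion makes it checkable by hand.\<close>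

lemma linear_vec_iff:
  "Vector_Spaces.linear (*s) (*) (f :: complex^'n::finite \<Rightarrow> complex) \<longleftrightarrow>
    (\<forall>u v. f (u + v) = f u + f v) \<and> (\<forall>c u. f (c *s u) = c * f u)"
  by (simp add: Vector_Spaces.linear_iff vec.vector_space_axioms vector_space_over_itself.vector_space_axioms)

lemma linear_double_sum:
  fixes g :: "nat \<Rightarrow> nat \<Rightarrow> complex^'n::finite \<Rightarrow> complex"
  assumes "\<And>j l. Vector_Spaces.linear (*s) (*) (g j l)"
  shows "Vector_Spaces.linear (*s) (*) (\<lambda>u. c * (\<Sum>j=1..K. \<Sum>l=j..K. g j l u))"
  using assms unfolding linear_vec_iff
  by (simp add: sum.distrib distrib_left sum_distrib_left mult.left_commute)

lemma dlog_coord_add: "dlog_coord e p i (u + v) = dlog_coord e p i u + dlog_coord e p i v"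
  by (simp add: dlog_coord_def add_divide_distrib)

lemma dlog_coord_scale: "dlog_coord e p i (c *s u) = c * dlog_coord e p i u"
  by (simp add: dlog_coord_def)

lemma dlog_coord_axis:
  assumes "bij_betw e {1..n} UNIV" "i \<in> {1..n}" "m \<in> {1..n}"
  shows "dlog_coord e p i (axis (e m) 1) = (if i = m then 1 / p $ e m else 0)"
  using inj_onD[OF bij_betw_imp_inj_on[OF assms(1)] _ assms(2,3)]
  by (auto simp: dlog_coord_def axis_def)

lemma holomorphic_standard_two_form_sigma0:
  fixes e :: "nat \<Rightarrow> 'n::finite"
  assumes "K \<ge> 1"
  shows "holomorphic_two_form_on torus (standard_two_form (sigma0 K e))"
proof -
  have "Vector_Spaces.linear (*s) (*) (two_form_derivative K e p b c)" for p b c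
    unfolding two_form_derivative_def [abs_def]
    by (rule linear_double_sum)
      (simp add: linear_vec_iff dlog_coord_add dlog_coord_scale algebra_simps)
  then have "holomorphic_map_on (\<lambda>p. standard_two_form (sigma0 K e) p u w) torus" for u w
    unfolding holomorphic_map_on_def using standard_two_form_sigma0_has_derivative[OF assms] by blast
  moreover have "Vector_Spaces.linear (*s) (*) (\<lambda>u. standard_two_form (sigma0 K e) p u w)"
    "Vector_Spaces.linear (*s) (*) (\<lambda>u. standard_two_form (sigma0 K e) p w u)"
    if "p \<in> torus" for p w
    unfolding standard_two_form_sigma0_eq[OF assms that]
    by (rule linear_double_sum, simp add: linear_vec_iff dlog_coord_add dlog_coord_scale algebra_simps)+
  moreover have "standard_two_form (sigma0 K e) p u u = 0" if "p \<in> torus" for p u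
    by (simp add: standard_two_form_sigma0_eq[OF assms that])
  ultimately show ?thesis
    unfolding holomorphic_two_form_on_def by blast
qed

text \<open>For \<xi> = d log y_(2j-1) and \<eta> = d log y_(2l), the (j,l) term is a multiple of
  (\<xi> + \<eta>) wedge \<xi> wedge \<eta>, which is zero. The three sums are first merged into one
  so that this cancellation happens termwise.\<close>

lemma closed_standard_two_form_sigma0:
  fixes e :: "nat \<Rightarrow> 'n::finite"
  assumes "K \<ge> 1" "p \<in> torus"
  shows "ext_deriv (standard_two_form (sigma0 K e)) p a b c = 0"
proof -
  have "frechet_derivative (\<lambda>q. standard_two_form (sigma0 K e) q b c) (at p) =
      two_form_derivative K e p b c" for b c
    by (rule frechet_derivative_at[OF standard_two_form_sigma0_has_derivative[OF assms], symmetric])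
  then show ?thesis
    unfolding ext_deriv_def two_form_derivative_def
    by (simp flip: distrib_left right_diff_distrib sum.distrib sum_subtractf) (simp add: algebra_simps)
qed

text \<open>The pairing between odd and even coordinates is triangular: testing against even basis
  vectors kills the initial sums of \<open>x\<close>, testing against odd ones kills the tail sums
  of \<open>z\<close>, and consecutive differences kill every coordinate of
  \<open>u\<close>.\<close>

lemma nondegenerate_standard_two_form_sigma0:
  fixes e :: "nat \<Rightarrow> 'n::finite"
  assumes "K \<ge> 1" "bij_betw e {1..2 * K} UNIV" "p \<in> torus"
    and zero: "\<And>w. standard_two_form (sigma0 K e) p u w = 0"
  shows "u = 0"
proof -
  have nz: "p $ i \<noteq> 0" for i
    using assms(3) by (simp add: torus_def)
  define x where "x j = dlog_coord e p (2 * j - 1) u" for j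
  define z where "z l = dlog_coord e p (2 * l) u" for l
  have pairing: "(\<Sum>j=1..K. \<Sum>l=j..K. x j * dlog_coord e p (2 * l) w -
      dlog_coord e p (2 * j - 1) w * z l) = 0" for w
    using zero[of w] unfolding standard_two_form_sigma0_eq[OF assms(1,3)] x_def z_def by simp
  have axis: "dlog_coord e p (2 * l) (axis (e (2 * m)) 1) = (if l = m then 1 / p $ e (2 * m) else 0)"
    "dlog_coord e p (2 * l - 1) (axis (e (2 * m)) 1) = 0"
    "dlog_coord e p (2 * l) (axis (e (2 * m - 1)) 1) = 0"
    "dlog_coord e p (2 * l - 1) (axis (e (2 * m - 1)) 1) = (if l = m then 1 / p $ e (2 * m - 1) else 0)"
    if "1 \<le> l" "l \<le> K" "1 \<le> m" "m \<le> K" for l m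
  proof -
    have "2 * l - 1 \<noteq> 2 * m" "2 * l \<noteq> 2 * m - 1" "2 * l - 1 = 2 * m - 1 \<longleftrightarrow> l = m"
      using that by presburger+
    moreover have "{2 * l, 2 * l - 1, 2 * m, 2 * m - 1} \<subseteq> {1..2 * K}"
      using that by auto
    ultimately show "dlog_coord e p (2 * l) (axis (e (2 * m)) 1) = (if l = m then 1 / p $ e (2 * m) else 0)"
      "dlog_coord e p (2 * l - 1) (axis (e (2 * m)) 1) = 0"
      "dlog_coord e p (2 * l) (axis (e (2 * m - 1)) 1) = 0"
      "dlog_coord e p (2 * l - 1) (axis (e (2 * m - 1)) 1) = (if l = m then 1 / p $ e (2 * m - 1) else 0)"
      by (simp_all add: dlog_coord_axis[OF assms(2)])
  qed
  \<comment> \<open>The empty case \<open>m = 0\<close> is kept for the difference that isolates the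
    first \<open>x\<close>.\<close>
  have x_sum: "(\<Sum>j=1..m. x j) = 0" if m: "m \<le> K" for m
  proof (cases "m = 0")
    case False
    have "0 = (\<Sum>j=1..K. \<Sum>l=j..K. if l = m then x j / p $ e (2 * m) else 0)"
      by (subst pairing[of "axis (e (2 * m)) 1", symmetric], intro sum.cong refl)
        (use m False in \<open>simp add: axis[unfolded One_nat_def]\<close>)
    also have "\<dots> = (\<Sum>j=1..K. if j \<le> m then x j / p $ e (2 * m) else 0)"
      using m by (intro sum.cong refl) simp
    also have "\<dots> = (\<Sum>j=1..m. x j / p $ e (2 * m))"
      using m by (intro sum.mono_neutral_cong_right) auto
    finally show ?thesis
      using nz by (simp flip: sum_divide_distrib)
  qed simp
  \<comment> \<open>There is no upper bound on \<open>m\<close>: the empty tail at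
    \<open>Suc K\<close> isolates the last \<open>z\<close>.\<close>
  have z_sum: "(\<Sum>l=m..K. z l) = 0" if m: "1 \<le> m" for m
  proof (cases "m \<le> K")
    case True
    have "0 = (\<Sum>j=1..K. \<Sum>l=j..K. if j = m then - z l / p $ e (2 * m - 1) else 0)"
      by (subst pairing[of "axis (e (2 * m - 1)) 1", symmetric], intro sum.cong refl)
        (use m True in \<open>simp add: axis[unfolded One_nat_def]\<close>)
    also have "\<dots> = (\<Sum>j=1..K. if j = m then \<Sum>l=m..K. - z l / p $ e (2 * m - 1) else 0)"
      by (intro sum.cong refl) auto
    also have "\<dots> = (\<Sum>l=m..K. - z l / p $ e (2 * m - 1))"
      using m True by simp
    finally show ?thesis
      using nz by (simp add: sum_negf flip: sum_divide_distrib)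
  qed simp
  have x: "x m = 0" if "1 \<le> m" "m \<le> K" for m
    using x_sum[of m] x_sum[of "m - 1"] that by (cases m) auto
  have z: "z m = 0" if "1 \<le> m" "m \<le> K" for m
    using z_sum[of m] z_sum[of "Suc m"] that by (simp add: sum.atLeast_Suc_atMost)
  have coord: "dlog_coord e p i u = 0" if "i \<in> {1..2 * K}" for i
  proof (cases "even i")
    case True
    then show ?thesis
      using that z[of "i div 2"] by (auto simp: z_def)
  next
    case False
    then obtain k where "i = 2 * k + 1"
      by (rule oddE)
    then show ?thesis
      using that x[of "k + 1"] by (auto simp: x_def)
  qed
  have "u $ i = 0" for i
  proof -
    obtain k where "k \<in> {1..2 * K}" "i = e k"
      using bij_betw_imp_surj_on[OF assms(2)] by blast
    then show ?thesis
      using coord[of k] nz[of i] by (simp add: dlog_coord_def)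
  qed
  then show ?thesis
    by (simp add: vec_eq_iff)
qed

theorem proposition3p6:
  fixes K :: nat and e :: "nat \<Rightarrow> 'n::finite"
  assumes "K \<ge> 1"
    and "bij_betw e {1..2 * K} (UNIV :: 'n set)"
  shows "(\<forall>y\<in>torus. \<forall>u w.
            standard_two_form (sigma0 K e) y u w =
              8 * (\<Sum>j=1..K. \<Sum>l=j..K.
                     wedge (dlog (\<lambda>y. y $ e (2 * j - 1))) (dlog (\<lambda>y. y $ e (2 * l))) y u w))
         \<and> symplectic_form_on torus (standard_two_form (sigma0 K e))"
proof
  \<comment> \<open>This passes from \<open>dlog\<close>, defined by Frechet derivatives, to the
    explicit quotients used throughout.\<close>
  have "wedge (dlog (\<lambda>y. y $ e i)) (dlog (\<lambda>y. y $ e j)) y u w =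
      wedge_at (dlog_coord e y i) (dlog_coord e y j) u w" if "y \<in> torus" for i j y u w
    using has_dlog_imp_dlog[OF has_dlog_dlog_coord[OF that]] by (simp add: wedge_def)
  then show "\<forall>y\<in>torus. \<forall>u w.
            standard_two_form (sigma0 K e) y u w =
              8 * (\<Sum>j=1..K. \<Sum>l=j..K.
                     wedge (dlog (\<lambda>y. y $ e (2 * j - 1))) (dlog (\<lambda>y. y $ e (2 * l))) y u w)"
    by (simp add: standard_two_form_sigma0_eq[OF assms(1)])
  show "symplectic_form_on torus (standard_two_form (sigma0 K e))"
    unfolding symplectic_form_on_def
    using open_torus holomorphic_standard_two_form_sigma0[OF assms(1)]
      closed_standard_two_form_sigma0[OF assms(1)] nondegenerate_standard_two_form_sigma0[OF assms]
    by blast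
qed

end
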